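(* Consider the following reconstruction problem. An undirected graph $G=(V,E,w)$ with $n=|V|$ vertices, $m=|E|$ edges and maximum degree $D$ (with $D\gg 1$ and $m/D=\omega(1)$ as $n\to\infty$) has a fixed edge structure, and its edge weights are independent and identically distributed random variables with Pareto cumulative distribution function $F(x)=1-x^{-\alpha}$ for $x\in[1,\infty)$, where $\alpha>0$ is a constant. The vertex set $V$ and the realized maximum edge weight $W_{\max}$ are known, but $E$ and $w$ are not. Using composite queries (any mixture of the queries $q_w(u,v,W_{\mathrm{thr}})$, $q_d(u,v,W_{\mathrm{thr}})$ and $q_c(u,S,W_{\mathrm{thr}})$ defined below), there is a randomized algorithm that reconstructs $E$ together with all edge weights with query complexity $\tilde{O}\left(\left(1+\frac{1}{\alpha}\log D\right)D^{3}n^{3/2}\right)$, where the bound is on the expected number of queries over the algorithm's internal randomness and holds asymptotically almost surely over the randomness of the edge weights.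
   Context: For a threshold $W_{\mathrm{thr}}\ge 1$, $G[w\ge W_{\mathrm{thr}}]$ denotes the spanning subgraph of $G$ on all of $V$ containing exactly the edges of weight at least $W_{\mathrm{thr}}$. The queries are: $q_w(u,v,W_{\mathrm{thr}})$ returns $w(u,v)$ if $uv$ is an edge of $G[w\ge W_{\mathrm{thr}}]$ and $0$ otherwise; $q_d(u,v,W_{\mathrm{thr}})$ returns the length (sum of weights) of a shortest weighted path between $u$ and $v$ in $G[w\ge W_{\mathrm{thr}}]$, and $+\infty$ if no path exists; for $u\in V$ and $S\subseteq V\setminus\{u\}$, $q_c(u,S,W_{\mathrm{thr}})$ returns $1$ if some $v\in S$ lies in the same connected component as $u$ in $G[w\ge W_{\mathrm{thr}}]$, and $0$ otherwise. Query complexity is the number of queries issued. $\tilde{O}(\cdot)$ hides polylogarithmic factors in $n$. "Asymptotically almost surely" means with probability tending to $1$ as $n\to\infty$; $\omega(1)$ denotes a quantity tending to infinity as $n\to\infty$. *)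

theory Defs
  imports "HOL-Probability.Probability"
begin

text \<open>Finite simple undirected graphs on a vertex set \<open>V\<close>; an edge \<open>uv\<close> is the two-element set
  \<open>{u, v}\<close>, and a weight function is only relevant on the edge set.\<close>

definition simple_graph :: "'v set \<Rightarrow> 'v set set \<Rightarrow> bool" where
  "simple_graph V E \<longleftrightarrow> finite V \<and> E \<subseteq> {{u, v} |u v. u \<in> V \<and> v \<in> V \<and> u \<noteq> v}"

definition vdegree :: "'v set set \<Rightarrow> 'v \<Rightarrow> nat" where
  "vdegree E v = card {e \<in> E. v \<in> e}"

definition max_degree :: "'v set \<Rightarrow> 'v set set \<Rightarrow> nat" where
  "max_degree V E = Max (vdegree E ` V)"

definition threshold_edges :: "'v set set \<Rightarrow> ('v set \<Rightarrow> real) \<Rightarrow> real \<Rightarrow> 'v set set" where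
  "threshold_edges E w t = {e \<in> E. t \<le> w e}"

fun path_edges :: "'v list \<Rightarrow> 'v set list" where
  "path_edges (x # y # zs) = {x, y} # path_edges (y # zs)"
| "path_edges _ = []"

definition is_path :: "'v set set \<Rightarrow> 'v \<Rightarrow> 'v \<Rightarrow> 'v list \<Rightarrow> bool" where
  "is_path F u v p \<longleftrightarrow>
     p \<noteq> [] \<and> hd p = u \<and> last p = v \<and> distinct p \<and> set (path_edges p) \<subseteq> F"

definition path_length :: "('v set \<Rightarrow> real) \<Rightarrow> 'v list \<Rightarrow> real" where
  "path_length w p = sum_list (map w (path_edges p))"

text \<open>In a finite graph there are only finitely many paths between two vertices, so the infimum
  is a minimum whenever there is a path; it is \<open>\<infinity>\<close> when there is none.\<close>

definition weighted_dist :: "'v set set \<Rightarrow> ('v set \<Rightarrow> real) \<Rightarrow> 'v \<Rightarrow> 'v \<Rightarrow> ereal" where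
  "weighted_dist F w u v = (INF p\<in>{p. is_path F u v p}. ereal (path_length w p))"

definition same_component :: "'v set set \<Rightarrow> 'v \<Rightarrow> 'v \<Rightarrow> bool" where
  "same_component F u v \<longleftrightarrow> (\<exists>p. is_path F u v p)"

datatype 'v query =
    Weight_Query 'v 'v real
  | Dist_Query 'v 'v real
  | Comp_Query 'v "'v set" real

fun legal_query :: "'v set \<Rightarrow> 'v query \<Rightarrow> bool" where
  "legal_query V (Weight_Query u v t) \<longleftrightarrow> u \<in> V \<and> v \<in> V \<and> 1 \<le> t"
| "legal_query V (Dist_Query u v t) \<longleftrightarrow> u \<in> V \<and> v \<in> V \<and> 1 \<le> t"
| "legal_query V (Comp_Query u S t) \<longleftrightarrow> u \<in> V \<and> S \<subseteq> V - {u} \<and> 1 \<le> t"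

fun answer :: "'v set set \<Rightarrow> ('v set \<Rightarrow> real) \<Rightarrow> 'v query \<Rightarrow> ereal" where
  "answer E w (Weight_Query u v t) =
     (if {u, v} \<in> threshold_edges E w t then ereal (w {u, v}) else 0)"
| "answer E w (Dist_Query u v t) = weighted_dist (threshold_edges E w t) w u v"
| "answer E w (Comp_Query u S t) =
     (if \<exists>v\<in>S. same_component (threshold_edges E w t) u v then 1 else 0)"

text \<open>Adaptive randomized query algorithms as (well-founded) decision trees: a node returns a
  result, asks a query and continues depending on the answer, or samples from a discrete
  distribution (the internal randomness) and continues depending on the sample.\<close>

datatype ('v, 'r) query_alg =
    Return 'r
  | Ask "'v query" "ereal \<Rightarrow> ('v, 'r) query_alg"
  | Sample "nat pmf" "nat \<Rightarrow> ('v, 'r) query_alg"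

primrec legal_alg :: "'v set \<Rightarrow> ('v, 'r) query_alg \<Rightarrow> bool" where
  "legal_alg V (Return r) \<longleftrightarrow> True"
| "legal_alg V (Ask q f) \<longleftrightarrow> legal_query V q \<and> (\<forall>a. legal_alg V (f a))"
| "legal_alg V (Sample p f) \<longleftrightarrow> (\<forall>x. legal_alg V (f x))"

text \<open>Joint distribution, over the internal randomness, of the returned result and the number of
  queries issued when the queries are answered by \<open>ans\<close>.\<close>

primrec run_alg :: "('v query \<Rightarrow> ereal) \<Rightarrow> ('v, 'r) query_alg \<Rightarrow> ('r \<times> nat) pmf" where
  "run_alg ans (Return r) = return_pmf (r, 0)"
| "run_alg ans (Ask q f) = map_pmf (\<lambda>(r, c). (r, Suc c)) (run_alg ans (f (ans q)))"
| "run_alg ans (Sample p f) = bind_pmf p (\<lambda>x. run_alg ans (f x))"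

definition expected_queries :: "('v query \<Rightarrow> ereal) \<Rightarrow> ('v, 'r) query_alg \<Rightarrow> ennreal" where
  "expected_queries ans A =
     (\<integral>\<^sup>+ x. of_nat (snd x) \<partial>measure_pmf (run_alg ans A))"

definition max_weight :: "'v set set \<Rightarrow> ('v set \<Rightarrow> real) \<Rightarrow> real" where
  "max_weight E w = Max (w ` E)"

definition pareto_cdf :: "real \<Rightarrow> real \<Rightarrow> real" where
  "pareto_cdf \<alpha> x = (if 1 \<le> x then 1 - x powr (- \<alpha>) else 0)"

definition iid_pareto_weights ::
    "'a measure \<Rightarrow> real \<Rightarrow> 'v set set \<Rightarrow> ('v set \<Rightarrow> 'a \<Rightarrow> real) \<Rightarrow> bool" where
  "iid_pareto_weights M \<alpha> E X \<longleftrightarrow>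
     prob_space M \<and>
     prob_space.indep_vars M (\<lambda>_. borel) X E \<and>
     (\<forall>e\<in>E. cdf (distr M borel (X e)) = pareto_cdf \<alpha>)"

text \<open>The event in question need not be known to be measurable, hence the measurable events
  \<open>A i\<close> contained in it; if it is measurable, this says that its probability tends to \<open>1\<close>.\<close>

definition asymptotically_almost_surely ::
    "(nat \<Rightarrow> 'a measure) \<Rightarrow> (nat \<Rightarrow> 'a \<Rightarrow> bool) \<Rightarrow> bool" where
  "asymptotically_almost_surely M P \<longleftrightarrow>
     (\<exists>A. (\<forall>i. A i \<in> sets (M i) \<and> (\<forall>\<omega>\<in>A i. P i \<omega>)) \<and>
          (\<lambda>i. measure (M i) (A i)) \<longlonglongrightarrow> 1)"

end

theory Submission imports Defs begin

text \<open>The distribution of the weights enters only through \<open>W\<^sub>m\<^sub>a\<^sub>x \<le> m powr (2 / \<alpha>)\<close>, which by a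
  union bound fails with probability at most \<open>1 / m\<close>; so \<open>O(1 + log n / \<alpha>)\<close> dyadic thresholds
  \<open>t = 2 ^ j\<close> cover all weights. For decreasing \<open>t\<close>, suppose that the edges of weight at least \<open>2 * t\<close>
  are known. In the graph of edges of weight at least \<open>t\<close> a path with two edges has length at least
  \<open>2 * t\<close>, so the new edges are exactly the pairs at distance less than \<open>2 * t\<close>.

  To find these pairs, choose about \<open>sqrt n\<close> centers \<open>A\<close> by the iterated sampling of Thorup and Zwick,
  such that every cluster \<open>{x. \<forall>a\<in>A. d b x < d a x}\<close> has about \<open>sqrt n\<close> elements. If \<open>a\<close> is the
  center nearest to a new edge \<open>u v\<close>, say to \<open>u\<close>, and \<open>b\<close> is the second vertex after \<open>a\<close> on a shortest
  path from \<open>a\<close> to \<open>u\<close>, then \<open>d b u \<le> d a u - 2 * t\<close>, so both \<open>u\<close> and \<open>v\<close> lie in the cluster of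
  \<open>b\<close>. So it suffices to query all pairs inside the clusters of the \<open>O(D\<^sup>2)\<close> vertices at most two steps
  away from each center. A component without a center is itself contained in a cluster, and its
  vertices are enumerated by bisection with component queries.\<close>


section \<open>Query algorithms\<close>

primrec bind_alg ::
    "('v, 'r) query_alg \<Rightarrow> ('r \<Rightarrow> ('v, 's) query_alg) \<Rightarrow> ('v, 's) query_alg" where
  "bind_alg (Return r) g = g r"
| "bind_alg (Ask q f) g = Ask q (\<lambda>a. bind_alg (f a) g)"
| "bind_alg (Sample p f) g = Sample p (\<lambda>x. bind_alg (f x) g)"

lemma legal_bind_alg:
  "legal_alg V A \<Longrightarrow> (\<And>r. legal_alg V (g r)) \<Longrightarrow> legal_alg V (bind_alg A g)"
  by (induction A) auto

lemma run_bind_alg: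
  "run_alg ans (bind_alg A g) =
     bind_pmf (run_alg ans A) (\<lambda>(r, c). map_pmf (\<lambda>(s, c'). (s, c + c')) (run_alg ans (g r)))"
proof (induction A)
  case (Return r)
  then show ?case by (simp add: bind_return_pmf case_prod_unfold)
next
  case (Ask q f)
  then show ?case
    by (simp add: map_bind_pmf bind_map_pmf case_prod_unfold pmf.map_comp o_def)
next
  case (Sample p f)
  then show ?case by (simp add: bind_assoc_pmf)
qed

definition result_pmf :: "('v query \<Rightarrow> ereal) \<Rightarrow> ('v, 'r) query_alg \<Rightarrow> 'r pmf" where
  "result_pmf ans A = map_pmf fst (run_alg ans A)"

lemma result_pmf_Return [simp]: "result_pmf ans (Return r) = return_pmf r"
  by (simp add: result_pmf_def)

lemma result_pmf_Ask [simp]: "result_pmf ans (Ask q f) = result_pmf ans (f (ans q))"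
  by (simp add: result_pmf_def pmf.map_comp o_def case_prod_unfold)

lemma result_pmf_bind_alg:
  "result_pmf ans (bind_alg A g) = bind_pmf (result_pmf ans A) (\<lambda>r. result_pmf ans (g r))"
  by (simp add: result_pmf_def run_bind_alg map_bind_pmf bind_map_pmf case_prod_unfold
      pmf.map_comp o_def)

lemma expected_queries_Return [simp]: "expected_queries ans (Return r) = 0"
  by (simp add: expected_queries_def)

lemma expected_queries_Ask [simp]:
  "expected_queries ans (Ask q f) = 1 + expected_queries ans (f (ans q))"
  by (simp add: expected_queries_def case_prod_unfold nn_integral_add)

lemma expected_queries_bind_alg:
  "expected_queries ans (bind_alg A g) =
     expected_queries ans A + (\<integral>\<^sup>+ r. expected_queries ans (g r) \<partial>measure_pmf (result_pmf ans A))"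
  by (simp add: result_pmf_def expected_queries_def run_bind_alg case_prod_unfold nn_integral_add)

definition draw :: "'r pmf \<Rightarrow> ('v, 'r) query_alg" where
  "draw p = Sample (map_pmf (to_nat_on (set_pmf p)) p) (\<lambda>i. Return (from_nat_into (set_pmf p) i))"

lemma legal_draw: "legal_alg V (draw p)"
  by (simp add: draw_def)

lemma result_pmf_draw [simp]: "result_pmf ans (draw p) = p"
proof -
  have "result_pmf ans (draw p) =
      map_pmf (\<lambda>x. from_nat_into (set_pmf p) (to_nat_on (set_pmf p) x)) p"
    by (simp add: draw_def result_pmf_def pmf.map_comp o_def flip: map_pmf_def)
  also have "\<dots> = map_pmf (\<lambda>x. x) p"
    by (intro map_pmf_cong) simp_all
  finally show ?thesis by simp
qed

lemma expected_queries_draw [simp]: "expected_queries ans (draw p) = 0"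
  by (simp add: draw_def expected_queries_def)

definition computes :: "('v query \<Rightarrow> ereal) \<Rightarrow> ('v, 'r) query_alg \<Rightarrow> 'r \<Rightarrow> nat \<Rightarrow> bool" where
  "computes ans A r c \<longleftrightarrow> result_pmf ans A = return_pmf r \<and> expected_queries ans A \<le> of_nat c"

lemma computes_Return: "computes ans (Return r) r c"
  by (simp add: computes_def)

lemma computes_Ask: "computes ans (f (ans q)) r c \<Longrightarrow> computes ans (Ask q f) r (Suc c)"
  by (simp add: computes_def add_left_mono)

lemma computes_bind_alg:
  "computes ans A r c \<Longrightarrow> computes ans (g r) s c' \<Longrightarrow> computes ans (bind_alg A g) s (c + c')"
  by (simp add: computes_def result_pmf_bind_alg expected_queries_bind_alg bind_return_pmf add_mono)

lemma computes_bind_Return: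
  "computes ans A r c \<Longrightarrow> h r = s \<Longrightarrow> computes ans (bind_alg A (\<lambda>r. Return (h r))) s c"
  using computes_bind_alg[of ans A r c "\<lambda>r. Return (h r)" s 0] by (simp add: computes_Return)

lemma computes_resultD:
  assumes "computes ans A r c" "(s, q) \<in> set_pmf (run_alg ans A)"
  shows "s = r"
proof -
  have "s \<in> set_pmf (result_pmf ans A)" using assms(2) by (force simp: result_pmf_def)
  then show ?thesis using assms(1) by (simp add: computes_def)
qed

lemma computes_mono: "computes ans A r c \<Longrightarrow> c \<le> c' \<Longrightarrow> computes ans A r c'"
  unfolding computes_def by (meson of_nat_mono order_trans)

definition list_of_set :: "'k set \<Rightarrow> 'k list" where
  "list_of_set P = (SOME xs. set xs = P \<and> distinct xs)"

lemma list_of_set: "finite P \<Longrightarrow> set (list_of_set P) = P \<and> distinct (list_of_set P)"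
  unfolding list_of_set_def using finite_distinct_list[of P] by (rule someI_ex)

primrec gather_list :: "('k \<Rightarrow> ('v, 'r) query_alg) \<Rightarrow> 'k list \<Rightarrow> ('v, 'k \<Rightarrow> 'r) query_alg" where
  "gather_list f [] = Return (\<lambda>_. undefined)"
| "gather_list f (x # xs) =
     bind_alg (f x) (\<lambda>r. bind_alg (gather_list f xs) (\<lambda>g. Return (g(x := r))))"

definition gather :: "('k \<Rightarrow> ('v, 'r) query_alg) \<Rightarrow> 'k set \<Rightarrow> ('v, 'k \<Rightarrow> 'r) query_alg" where
  "gather f P = gather_list f (list_of_set P)"

lemma legal_gather:
  assumes "finite P" and "\<And>x. x \<in> P \<Longrightarrow> legal_alg V (f x)"
  shows "legal_alg V (gather f P)"
proof -
  have "(\<forall>x\<in>set xs. legal_alg V (f x)) \<Longrightarrow> legal_alg V (gather_list f xs)" for xs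
    by (induction xs) (auto intro!: legal_bind_alg)
  then show ?thesis using assms list_of_set[of P] by (auto simp: gather_def)
qed

lemma computes_gather_list:
  assumes "\<And>x. x \<in> set xs \<Longrightarrow> computes ans (f x) (r x) (c x)"
  shows "computes ans (gather_list f xs) (restrict r (set xs)) (sum_list (map c xs))"
  using assms
proof (induction xs)
  case Nil
  then show ?case by (simp add: computes_Return restrict_def)
next
  case (Cons y ys)
  have "computes ans (gather_list f ys) (restrict r (set ys)) (sum_list (map c ys))"
    by (rule Cons.IH) (simp add: Cons.prems)
  then have "computes ans (bind_alg (gather_list f ys) (\<lambda>g. Return (g(y := r y))))
      (restrict r (set (y # ys))) (sum_list (map c ys))"
    by (rule computes_bind_Return) (auto simp: fun_eq_iff)
  then show ?case
    unfolding gather_list.simps list.map sum_list.Cons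
    by (intro computes_bind_alg[where r = "r y"]) (simp_all only: Cons.prems list.set_intros)
qed

lemma computes_gather:
  assumes "finite P" and "\<And>x. x \<in> P \<Longrightarrow> computes ans (f x) (r x) (c x)"
  shows "computes ans (gather f P) (restrict r P) (\<Sum>x\<in>P. c x)"
  using computes_gather_list[of "list_of_set P" ans f r c] assms list_of_set[of P]
  by (simp add: gather_def sum_list_distinct_conv_sum_set)

section \<open>Random subsets\<close>

definition random_subset :: "real \<Rightarrow> 'a set \<Rightarrow> 'a set pmf" where
  "random_subset q V = map_pmf (\<lambda>f. {x \<in> V. f x}) (Pi_pmf V False (\<lambda>_. bernoulli_pmf q))"

lemma random_subset_subset: "S \<in> set_pmf (random_subset q V) \<Longrightarrow> S \<subseteq> V"
  by (auto simp: random_subset_def)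

lemma prob_random_subset_disjoint:
  assumes "0 \<le> q" "q \<le> 1" "finite V" "C \<subseteq> V"
  shows "measure_pmf.prob (random_subset q V) {S. S \<inter> C = {}} = (1 - q) ^ card C"
proof -
  have "{f. {x \<in> V. f x} \<inter> C = {}} = Pi V (\<lambda>x. if x \<in> C then {False} else UNIV)"
    using assms(4) by (auto simp: Pi_def)
  then have "measure_pmf.prob (random_subset q V) {S. S \<inter> C = {}} =
      (\<Prod>x\<in>V. measure_pmf.prob (bernoulli_pmf q) (if x \<in> C then {False} else UNIV))"
    using assms(3) by (simp add: random_subset_def vimage_def measure_Pi_pmf_Pi)
  also have "\<dots> = (\<Prod>x\<in>V. if x \<in> C then 1 - q else 1)"
    using assms(1,2) by (intro prod.cong refl) (simp add: measure_pmf_single)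
  also have "\<dots> = (1 - q) ^ card C"
    using assms(3,4) by (simp add: prod.If_cases Int_absorb1)
  finally show ?thesis .
qed

lemma prob_random_subset_disjoint_le:
  assumes "0 \<le> p" "p \<le> 1" "finite V" "C \<subseteq> V"
  shows "measure_pmf.prob (random_subset p V) {T. K < card C \<and> T \<inter> C = {}} \<le> (1 - p) ^ K"
  using assms
  by (cases "K < card C") (auto simp: prob_random_subset_disjoint intro: power_decreasing)

lemma prob_random_subset_meets:
  assumes "0 \<le> q" "q \<le> 1" "finite V" "C \<subseteq> V"
  shows "measure_pmf.prob (random_subset q V) {S. S \<inter> C \<noteq> {}} = 1 - (1 - q) ^ card C"
proof -
  have "{S. S \<inter> C \<noteq> {}} = - {S. S \<inter> C = {}}" by auto
  then show ?thesis
    using prob_random_subset_disjoint[OF assms] measure_pmf.prob_compl[of "{S. S \<inter> C = {}}"]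
    by (simp add: Compl_eq_Diff_UNIV)
qed

lemma prob_random_subset_meets_le:
  assumes "0 \<le> q" "q \<le> 1" "finite V" "C \<subseteq> V"
  shows "measure_pmf.prob (random_subset q V) {S. S \<inter> C \<noteq> {}} \<le> q * card C"
  using Bernoulli_inequality[of "- q" "card C"] assms(2)
  by (simp add: prob_random_subset_meets[OF assms] mult.commute)

lemma nn_integral_card_Collect:
  assumes "finite W"
  shows "(\<integral>\<^sup>+ S. of_nat (card {b \<in> W. P b S}) \<partial>measure_pmf p) =
    (\<Sum>b\<in>W. ennreal (measure_pmf.prob p {S. P b S}))"
proof -
  have "of_nat (card {b \<in> W. P b S}) = (\<Sum>b\<in>W. indicator {S. P b S} S :: ennreal)" for S
    using assms by (simp add: indicator_def sum.If_cases Int_def)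
  then show ?thesis by (simp add: nn_integral_sum measure_pmf.emeasure_eq_measure)
qed

lemma expected_card_random_subset:
  assumes "0 \<le> q" "q \<le> 1" "finite V"
  shows "(\<integral>\<^sup>+ S. of_nat (card S) \<partial>measure_pmf (random_subset q V)) = ennreal (q * card V)"
proof -
  have "(\<integral>\<^sup>+ S. of_nat (card S) \<partial>measure_pmf (random_subset q V)) =
      (\<integral>\<^sup>+ S. of_nat (card {x \<in> V. S \<inter> {x} \<noteq> {}}) \<partial>measure_pmf (random_subset q V))"
    by (intro nn_integral_cong_AE)
      (auto simp: AE_measure_pmf_iff dest!: random_subset_subset intro!: arg_cong[where f = card])
  also have "\<dots> = (\<Sum>x\<in>V. ennreal q)"
    unfolding nn_integral_card_Collect[OF assms(3)] using assms
    by (intro sum.cong refl) (subst prob_random_subset_meets, auto)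
  finally show ?thesis using assms
    by (simp add: ennreal_of_nat_eq_real_of_nat mult.commute flip: ennreal_mult)
qed

lemma sum_power_rank_le:
  fixes f :: "'b \<Rightarrow> 'c :: linorder" and r :: real
  assumes "finite W" "0 \<le> r" "r \<le> 1"
  shows "(1 - r) * (\<Sum>b\<in>W. r ^ card {y \<in> W. f y \<le> f b}) \<le> 1 - r ^ card W"
  using assms(1)
proof (induction W rule: finite_ranking_induct[where f = f])
  case (insert x S)
  show ?case
  proof (cases "x \<in> S")
    case False
    have "{y \<in> insert x S. f y \<le> f x} = insert x S" using insert.hyps by auto
    then have "(\<Sum>b\<in>insert x S. r ^ card {y \<in> insert x S. f y \<le> f b}) =
        r ^ Suc (card S) + (\<Sum>b\<in>S. r ^ card {y \<in> insert x S. f y \<le> f b})"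
      using False insert.hyps by simp
    also have "\<dots> \<le> r ^ card S + (\<Sum>b\<in>S. r ^ card {y \<in> S. f y \<le> f b})"
      using assms(2,3) insert.hyps by (intro add_mono sum_mono power_decreasing card_mono) auto
    finally have "(1 - r) * (\<Sum>b\<in>insert x S. r ^ card {y \<in> insert x S. f y \<le> f b})
        \<le> (1 - r) * (r ^ card S + (\<Sum>b\<in>S. r ^ card {y \<in> S. f y \<le> f b}))"
      using assms(3) by (intro mult_left_mono) auto
    also have "\<dots> \<le> (1 - r) * r ^ card S + (1 - r ^ card S)"
      using insert.IH by (simp only: distrib_left add_left_mono)
    also have "\<dots> = 1 - r ^ card (insert x S)"
      using False insert.hyps by (simp add: left_diff_distrib)
    finally show ?thesis .
  qed (use insert in \<open>simp add: insert_absorb\<close>)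
qed simp

text \<open>The element \<open>b\<close> of rank \<open>i\<close> with respect to \<open>f\<close> counts only if none of the first \<open>i\<close> elements
  is sampled, which has probability \<open>(1 - q) ^ i\<close>.\<close>

lemma expected_card_below_random_subset:
  fixes f :: "'b \<Rightarrow> 'c :: linorder"
  assumes "finite W" "0 < q" "q \<le> 1"
  shows "(\<integral>\<^sup>+ S. of_nat (card {b \<in> W. \<forall>a\<in>S. f b < f a}) \<partial>measure_pmf (random_subset q W)) \<le>
    ennreal (1 / q)"
proof -
  have "(\<integral>\<^sup>+ S. of_nat (card {b \<in> W. \<forall>a\<in>S. f b < f a}) \<partial>measure_pmf (random_subset q W)) =
      (\<integral>\<^sup>+ S. of_nat (card {b \<in> W. S \<inter> {y \<in> W. f y \<le> f b} = {}}) \<partial>measure_pmf (random_subset q W))"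
    by (intro nn_integral_cong_AE)
      (force simp: AE_measure_pmf_iff not_le dest!: random_subset_subset
        intro!: arg_cong[where f = card])
  also have "\<dots> = ennreal (\<Sum>b\<in>W. (1 - q) ^ card {y \<in> W. f y \<le> f b})"
    unfolding nn_integral_card_Collect[OF assms(1)] using assms
    by (simp add: prob_random_subset_disjoint sum_ennreal)
  also have "\<dots> \<le> ennreal (1 / q)"
    using sum_power_rank_le[OF assms(1), of "1 - q" f] assms(2,3)
    by (intro ennreal_leI)
      (auto simp: pos_le_divide_eq mult.commute elim!: order_trans)
  finally show ?thesis .
qed

section \<open>Random centers with small clusters\<close>

definition cluster :: "'v set \<Rightarrow> ('v \<Rightarrow> 'v \<Rightarrow> 'c :: linorder) \<Rightarrow> 'v set \<Rightarrow> 'v \<Rightarrow> 'v set" where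
  "cluster V d A b = {x \<in> V. \<forall>a\<in>A. d b x < d a x}"

lemma cluster_subset: "cluster V d A b \<subseteq> V"
  by (auto simp: cluster_def)

lemma cluster_antimono: "A \<subseteq> B \<Longrightarrow> cluster V d B b \<subseteq> cluster V d A b"
  by (auto simp: cluster_def)

lemma cluster_member_eq_empty: "b \<in> A \<Longrightarrow> cluster V d A b = {}"
  by (auto simp: cluster_def)

lemma card_cluster_le:
  assumes "finite V"
  shows "card (cluster V d A b) \<le> card V"
  using assms by (intro card_mono cluster_subset)

lemma card_cluster_antimono:
  assumes "finite V" "A \<subseteq> B"
  shows "card (cluster V d B b) \<le> card (cluster V d A b)"
  using assms by (intro card_mono cluster_antimono) (auto intro: finite_subset[OF cluster_subset])

lemma sum_card_cluster:
  assumes "finite V" "finite W"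
  shows "(\<Sum>b\<in>W. card (cluster V d A b)) = (\<Sum>x\<in>V. card {b \<in> W. \<forall>a\<in>A. d b x < d a x})"
  unfolding cluster_def using assms by (intro sum_multicount_gen) auto

definition hit_clusters ::
    "'v set \<Rightarrow> ('v \<Rightarrow> 'v \<Rightarrow> 'c :: linorder) \<Rightarrow> 'v set \<Rightarrow> 'v set \<Rightarrow> 'v set \<Rightarrow> 'v set" where
  "hit_clusters V d A W T = {b \<in> W. T \<inter> cluster V d A b \<noteq> {}}"

lemma hit_clusters_subset: "hit_clusters V d A W T \<subseteq> W"
  by (auto simp: hit_clusters_def)

lemma hit_clusters_cong:
  assumes "\<And>b x. b \<in> A \<union> W \<Longrightarrow> x \<in> T \<Longrightarrow> d b x = d' b x"
  shows "hit_clusters V d A W T = hit_clusters V d' A W T"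
proof -
  have "T \<inter> cluster V d A b = T \<inter> cluster V d' A b" if "b \<in> W" for b
    using assms that by (auto simp: cluster_def)
  then show ?thesis by (auto simp: hit_clusters_def)
qed

text \<open>Invariant: with high probability, every vertex outside \<open>W\<close> has a small cluster with respect
  to \<open>A\<close>. The sample \<open>T\<close> is a probe: a vertex leaves \<open>W\<close> when its cluster avoids \<open>T\<close>. The
  sampling rate for new centers doubles in each round while the expected size of \<open>W\<close> halves, so each
  round contributes equally many centers; the final rate is \<open>1\<close>.\<close>

primrec centers_pmf ::
    "'v set \<Rightarrow> ('v \<Rightarrow> 'v \<Rightarrow> 'c :: linorder) \<Rightarrow> real \<Rightarrow> nat \<Rightarrow> 'v set \<Rightarrow> 'v set \<Rightarrow> 'v set pmf" where
  "centers_pmf V d p 0 A W = return_pmf (A \<union> W)"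
| "centers_pmf V d p (Suc k) A W =
     bind_pmf (random_subset (1 / 2 ^ Suc k) W) (\<lambda>S.
     bind_pmf (random_subset p V) (\<lambda>T.
       centers_pmf V d p k (A \<union> S) (hit_clusters V d (A \<union> S) W T)))"

lemma centers_pmf_subset:
  assumes "A \<subseteq> V" "W \<subseteq> V" "B \<in> set_pmf (centers_pmf V d p k A W)"
  shows "B \<subseteq> V"
  using assms
proof (induction k arbitrary: A W)
  case (Suc k)
  from Suc.prems(3) obtain S T where "S \<in> set_pmf (random_subset (1 / 2 ^ Suc k) W)"
    and result: "B \<in> set_pmf (centers_pmf V d p k (A \<union> S) (hit_clusters V d (A \<union> S) W T))"
    unfolding centers_pmf.simps set_bind_pmf by blast
  then have "A \<union> S \<subseteq> V"
    using Suc.prems(1,2) random_subset_subset[of S] by blast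
  moreover have "hit_clusters V d (A \<union> S) W T \<subseteq> V"
    using Suc.prems(2) hit_clusters_subset by (rule subset_trans[rotated])
  ultimately show ?case using result by (rule Suc.IH)
qed simp

lemma expected_card_hit_clusters_le:
  assumes "finite V" "finite W" "0 \<le> p" "p \<le> 1"
  shows "(\<integral>\<^sup>+ T. of_nat (card (hit_clusters V d A W T)) \<partial>measure_pmf (random_subset p V)) \<le>
    ennreal p * of_nat (\<Sum>b\<in>W. card (cluster V d A b))"
proof -
  have "(\<integral>\<^sup>+ T. of_nat (card (hit_clusters V d A W T)) \<partial>measure_pmf (random_subset p V)) =
      (\<Sum>b\<in>W. ennreal (measure_pmf.prob (random_subset p V) {T. T \<inter> cluster V d A b \<noteq> {}}))"
    unfolding hit_clusters_def by (rule nn_integral_card_Collect[OF assms(2)])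
  also have "\<dots> \<le> (\<Sum>b\<in>W. ennreal (p * card (cluster V d A b)))"
    using assms by (intro sum_mono ennreal_leI prob_random_subset_meets_le cluster_subset)
  also have "\<dots> = ennreal p * of_nat (\<Sum>b\<in>W. card (cluster V d A b))"
    using assms(3) by (simp add: ennreal_of_nat_eq_real_of_nat sum_ennreal
        flip: sum_distrib_left ennreal_mult of_nat_sum)
  finally show ?thesis .
qed

lemma expected_sum_card_cluster_le:
  assumes "finite V" "finite W" "0 < q" "q \<le> 1"
  shows "(\<integral>\<^sup>+ S. of_nat (\<Sum>b\<in>W. card (cluster V d (A \<union> S) b)) \<partial>measure_pmf (random_subset q W)) \<le>
    ennreal (real (card V) / q)"
proof -
  have "(\<integral>\<^sup>+ S. of_nat (\<Sum>b\<in>W. card (cluster V d (A \<union> S) b)) \<partial>measure_pmf (random_subset q W))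
    \<le> (\<integral>\<^sup>+ S. (\<Sum>x\<in>V. of_nat (card {b \<in> W. \<forall>a\<in>S. d b x < d a x})) \<partial>measure_pmf (random_subset q W))"
    unfolding sum_card_cluster[OF assms(1,2)] of_nat_sum using assms(2)
    by (intro nn_integral_mono sum_mono of_nat_mono card_mono) auto
  also have "\<dots> =
      (\<Sum>x\<in>V. \<integral>\<^sup>+ S. of_nat (card {b \<in> W. \<forall>a\<in>S. d b x < d a x}) \<partial>measure_pmf (random_subset q W))"
    by (simp add: nn_integral_sum)
  also have "\<dots> \<le> (\<Sum>x\<in>V. ennreal (1 / q))"
    using assms by (intro sum_mono expected_card_below_random_subset)
  also have "\<dots> = ennreal (real (card V) / q)"
    using assms(3) by (simp add: ennreal_of_nat_eq_real_of_nat flip: ennreal_mult)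
  finally show ?thesis .
qed

lemma expected_card_survivors_le:
  assumes "finite V" "finite W" "0 \<le> p" "p \<le> 1" "0 < q" "q \<le> 1"
  shows "(\<integral>\<^sup>+ S. \<integral>\<^sup>+ T. of_nat (card (hit_clusters V d (A \<union> S) W T)) \<partial>measure_pmf (random_subset p V)
      \<partial>measure_pmf (random_subset q W)) \<le> ennreal (p * card V / q)"
proof -
  have "(\<integral>\<^sup>+ S. \<integral>\<^sup>+ T. of_nat (card (hit_clusters V d (A \<union> S) W T)) \<partial>measure_pmf (random_subset p V)
      \<partial>measure_pmf (random_subset q W))
    \<le> (\<integral>\<^sup>+ S. ennreal p * of_nat (\<Sum>b\<in>W. card (cluster V d (A \<union> S) b))
      \<partial>measure_pmf (random_subset q W))"
    using assms by (intro nn_integral_mono expected_card_hit_clusters_le)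
  also have "\<dots> \<le> ennreal p * ennreal (real (card V) / q)"
    using assms by (simp add: nn_integral_cmult mult_left_mono expected_sum_card_cluster_le
        del: of_nat_sum)
  finally show ?thesis using assms(3,5) by (simp flip: ennreal_mult)
qed

lemma expected_card_centers_le:
  assumes "finite V" "finite W" "0 \<le> p" "p \<le> 1"
  shows "(\<integral>\<^sup>+ B. of_nat (card B) \<partial>measure_pmf (centers_pmf V d p k A W)) \<le>
    ennreal (card A + card W / 2 ^ k + 2 * real k * p * card V)"
  using assms(2)
proof (induction k arbitrary: A W)
  case 0
  have "card (A \<union> W) \<le> card A + card W" by (rule card_Un_le)
  then show ?case
    by (simp add: ennreal_of_nat_eq_real_of_nat ennreal_leI flip: ennreal_plus)
next
  case (Suc k)
  let ?q = "1 / 2 ^ Suc k :: real" and ?c = "ennreal (card A + 2 * real k * p * card V)"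
  let ?H = "\<lambda>S T. hit_clusters V d (A \<union> S) W T"
  have rate: "0 < ?q" "?q \<le> 1" by (simp_all add: divide_le_eq_1 one_le_power del: power_Suc)
  have "(\<integral>\<^sup>+ B. of_nat (card B) \<partial>measure_pmf (centers_pmf V d p k (A \<union> S) (?H S T)))
      \<le> ?c + of_nat (card S) + ennreal (1 / 2 ^ k) * of_nat (card (?H S T))" for S T
  proof -
    have "(\<integral>\<^sup>+ B. of_nat (card B) \<partial>measure_pmf (centers_pmf V d p k (A \<union> S) (?H S T)))
        \<le> ennreal (card (A \<union> S) + card (?H S T) / 2 ^ k + 2 * real k * p * card V)"
      using finite_subset[OF hit_clusters_subset Suc.prems] by (rule Suc.IH)
    also have "\<dots> \<le> ennreal (card A + 2 * real k * p * card V + card S + 1 / 2 ^ k * card (?H S T))"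
      using card_Un_le[of A S] by (intro ennreal_leI) simp
    finally show ?thesis
      using assms(3) by (simp add: ennreal_of_nat_eq_real_of_nat flip: ennreal_mult ennreal_plus)
  qed
  then have "(\<integral>\<^sup>+ B. of_nat (card B) \<partial>measure_pmf (centers_pmf V d p (Suc k) A W)) \<le>
      (\<integral>\<^sup>+ S. \<integral>\<^sup>+ T. ?c + of_nat (card S) + ennreal (1 / 2 ^ k) * of_nat (card (?H S T))
        \<partial>measure_pmf (random_subset p V) \<partial>measure_pmf (random_subset ?q W))"
    by (auto intro!: nn_integral_mono simp del: power_Suc)
  also have "\<dots> = ?c + (\<integral>\<^sup>+ S. of_nat (card S) \<partial>measure_pmf (random_subset ?q W)) +
      ennreal (1 / 2 ^ k) * (\<integral>\<^sup>+ S. \<integral>\<^sup>+ T. of_nat (card (?H S T)) \<partial>measure_pmf (random_subset p V)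
        \<partial>measure_pmf (random_subset ?q W))"
    by (simp add: nn_integral_add nn_integral_cmult del: power_Suc)
  also have "\<dots> \<le> ?c + ennreal (?q * card W) + ennreal (1 / 2 ^ k) * ennreal (p * card V / ?q)"
    using assms(1,3,4) rate Suc.prems
    by (intro add_mono mult_left_mono expected_card_survivors_le)
      (auto simp: expected_card_random_subset simp del: power_Suc)
  also have "\<dots> = ennreal (card A + card W / 2 ^ Suc k + 2 * real (Suc k) * p * card V)"
    using assms(3) by (simp add: field_simps flip: ennreal_mult ennreal_plus)
  finally show ?case .
qed

lemma nn_integral_random_subset_le:
  assumes "finite V" "0 \<le> p" "p \<le> 1" "C \<subseteq> V" "0 \<le> c"
    and "\<And>T. f T \<le> 1" and hit: "\<And>T. T \<inter> C \<noteq> {} \<or> card C \<le> K \<Longrightarrow> f T \<le> ennreal c"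
  shows "(\<integral>\<^sup>+ T. f T \<partial>measure_pmf (random_subset p V)) \<le> ennreal ((1 - p) ^ K + c)"
proof -
  let ?miss = "{T. K < card C \<and> T \<inter> C = {}}"
  have "f T \<le> indicator ?miss T + ennreal c" for T
    using assms(6)[of T] hit[of T] by (cases "T \<in> ?miss") (auto intro: add_increasing2)
  then have "(\<integral>\<^sup>+ T. f T \<partial>measure_pmf (random_subset p V)) \<le>
      (\<integral>\<^sup>+ T. indicator ?miss T + ennreal c \<partial>measure_pmf (random_subset p V))"
    by (intro nn_integral_mono)
  also have "\<dots> = ennreal (measure_pmf.prob (random_subset p V) ?miss + c)"
    using assms(5) by (simp add: nn_integral_add measure_pmf.emeasure_eq_measure)
  also have "\<dots> \<le> ennreal ((1 - p) ^ K + c)"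
    using assms(1-4) by (intro ennreal_leI add_right_mono prob_random_subset_disjoint_le)
  finally show ?thesis .
qed

lemma emeasure_large_cluster_centers_le:
  assumes "finite V" "0 \<le> p" "p \<le> 1" "b \<in> W \<or> card (cluster V d A b) \<le> K"
  shows "emeasure (measure_pmf (centers_pmf V d p k A W)) {B. K < card (cluster V d B b)} \<le>
    ennreal (real k * (1 - p) ^ K)"
  using assms(4)
proof (induction k arbitrary: A W)
  case 0
  have "card (cluster V d (A \<union> W) b) \<le> K"
  proof (cases "b \<in> W")
    case False
    then show ?thesis using 0 card_cluster_antimono[OF assms(1), of A "A \<union> W" d b] by auto
  qed (simp add: cluster_member_eq_empty)
  then show ?case by (simp add: not_less)
next
  case (Suc k)
  let ?large = "{B. K < card (cluster V d B b)}"
  let ?centers = "\<lambda>S T. centers_pmf V d p k (A \<union> S) (hit_clusters V d (A \<union> S) W T)"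
  have probe: "(\<integral>\<^sup>+ T. emeasure (measure_pmf (?centers S T)) ?large
      \<partial>measure_pmf (random_subset p V)) \<le> ennreal ((1 - p) ^ K + real k * (1 - p) ^ K)" for S
  proof (rule nn_integral_random_subset_le[OF assms(1-3) cluster_subset])
    fix T assume "T \<inter> cluster V d (A \<union> S) b \<noteq> {} \<or> card (cluster V d (A \<union> S) b) \<le> K"
    moreover have "card (cluster V d (A \<union> S) b) \<le> card (cluster V d A b)"
      using assms(1) by (intro card_cluster_antimono) auto
    ultimately have "b \<in> hit_clusters V d (A \<union> S) W T \<or> card (cluster V d (A \<union> S) b) \<le> K"
      using Suc.prems by (auto simp: hit_clusters_def)
    then show "emeasure (measure_pmf (?centers S T)) ?large \<le> ennreal (real k * (1 - p) ^ K)"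
      by (rule Suc.IH)
  qed (use assms(3) in \<open>simp_all add: measure_pmf.emeasure_le_1\<close>)
  have "emeasure (measure_pmf (centers_pmf V d p (Suc k) A W)) ?large =
      (\<integral>\<^sup>+ S. \<integral>\<^sup>+ T. emeasure (measure_pmf (?centers S T)) ?large
        \<partial>measure_pmf (random_subset p V) \<partial>measure_pmf (random_subset (1 / 2 ^ Suc k) W))" by simp
  also have "\<dots> \<le> (\<integral>\<^sup>+ S. ennreal (real (Suc k) * (1 - p) ^ K)
      \<partial>measure_pmf (random_subset (1 / 2 ^ Suc k) W))"
    using probe by (intro nn_integral_mono) (simp add: algebra_simps)
  finally show ?case by simp
qed

lemma emeasure_some_large_cluster_centers_le:
  assumes "finite V" "0 \<le> p" "p \<le> 1"
  shows "emeasure (measure_pmf (centers_pmf V d p k A V)) {B. \<exists>b\<in>V. K < card (cluster V d B b)} \<le>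
    ennreal (real (card V) * (real k * (1 - p) ^ K))"
proof -
  let ?M = "measure_pmf (centers_pmf V d p k A V)"
  have "{B. \<exists>b\<in>V. K < card (cluster V d B b)} = (\<Union>b\<in>V. {B. K < card (cluster V d B b)})" by auto
  then have "emeasure ?M {B. \<exists>b\<in>V. K < card (cluster V d B b)}
      \<le> (\<Sum>b\<in>V. emeasure ?M {B. K < card (cluster V d B b)})"
    using assms(1) by (simp add: emeasure_subadditive_finite)
  also have "\<dots> \<le> (\<Sum>b\<in>V. ennreal (real k * (1 - p) ^ K))"
    using assms by (intro sum_mono emeasure_large_cluster_centers_le) auto
  also have "\<dots> = ennreal (real (card V) * (real k * (1 - p) ^ K))"
    using assms(3) by (simp add: ennreal_of_nat_eq_real_of_nat flip: ennreal_mult)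
  finally show ?thesis .
qed

definition dist_table ::
    "'v set \<Rightarrow> real \<Rightarrow> ('v \<times> 'v) set \<Rightarrow> ('v, 'v \<times> 'v \<Rightarrow> ereal) query_alg" where
  "dist_table V t P = gather (\<lambda>(x, y). Ask (Dist_Query x y t) Return) (P \<inter> V \<times> V)"

lemma legal_dist_table: "finite V \<Longrightarrow> 1 \<le> t \<Longrightarrow> legal_alg V (dist_table V t P)"
  unfolding dist_table_def by (intro legal_gather) auto

lemma computes_dist_table:
  assumes "finite V" "P \<subseteq> V \<times> V"
  shows "computes ans (dist_table V t P) (restrict (\<lambda>(x, y). ans (Dist_Query x y t)) P) (card P)"
proof -
  have pairs: "P \<inter> V \<times> V = P" "finite P" using assms by (auto intro: finite_subset)
  have "computes ans (gather (\<lambda>(x, y). Ask (Dist_Query x y t) Return) P)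
      (restrict (\<lambda>(x, y). ans (Dist_Query x y t)) P) (\<Sum>k\<in>P. Suc 0)"
    by (intro computes_gather pairs) (auto intro: computes_Ask computes_Return)
  then show ?thesis by (simp add: dist_table_def pairs)
qed

primrec choose_centers ::
    "'v set \<Rightarrow> real \<Rightarrow> real \<Rightarrow> nat \<Rightarrow> 'v set \<Rightarrow> 'v set \<Rightarrow> ('v, 'v set) query_alg" where
  "choose_centers V t p 0 A W = Return (A \<union> W)"
| "choose_centers V t p (Suc k) A W =
     bind_alg (draw (random_subset (1 / 2 ^ Suc k) W)) (\<lambda>S.
     bind_alg (draw (random_subset p V)) (\<lambda>T.
     bind_alg (dist_table V t (V \<times> T)) (\<lambda>g.
       choose_centers V t p k (A \<union> S) (hit_clusters V (curry g) (A \<union> S) W T))))"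

lemma legal_choose_centers:
  "finite V \<Longrightarrow> 1 \<le> t \<Longrightarrow> legal_alg V (choose_centers V t p k A W)"
  by (induction k arbitrary: A W) (auto intro!: legal_bind_alg legal_draw legal_dist_table)

lemma result_pmf_choose_centers:
  assumes "finite V" "A \<subseteq> V" "W \<subseteq> V"
  shows "result_pmf ans (choose_centers V t p k A W) =
    centers_pmf V (\<lambda>x y. ans (Dist_Query x y t)) p k A W"
  using assms(2,3)
proof (induction k arbitrary: A W)
  case (Suc k)
  let ?d = "\<lambda>x y. ans (Dist_Query x y t)"
  have "result_pmf ans (bind_alg (dist_table V t (V \<times> T)) (\<lambda>g.
        choose_centers V t p k (A \<union> S) (hit_clusters V (curry g) (A \<union> S) W T))) =
      centers_pmf V ?d p k (A \<union> S) (hit_clusters V ?d (A \<union> S) W T)"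
    if "S \<subseteq> W" "T \<subseteq> V" for S T
  proof -
    have "A \<union> S \<union> W \<subseteq> V" using Suc.prems that by blast
    then have "hit_clusters V (curry (restrict (\<lambda>(x, y). ?d x y) (V \<times> T))) (A \<union> S) W T =
        hit_clusters V ?d (A \<union> S) W T"
      by (intro hit_clusters_cong) auto
    moreover have "A \<union> S \<subseteq> V" "hit_clusters V ?d (A \<union> S) W T \<subseteq> V"
      using Suc.prems that hit_clusters_subset[of V ?d "A \<union> S" W T] by auto
    moreover have "V \<times> T \<subseteq> V \<times> V" using that by blast
    ultimately show ?thesis
      using computes_dist_table[OF assms(1), of "V \<times> T" ans t]
      by (simp add: computes_def result_pmf_bind_alg bind_return_pmf Suc.IH)
  qed
  then show ?case
    unfolding choose_centers.simps centers_pmf.simps result_pmf_bind_alg[of _ "draw _"]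
      result_pmf_draw
    by (intro bind_pmf_cong refl) (auto dest!: random_subset_subset)
qed simp

lemma expected_queries_choose_centers:
  assumes "finite V" "0 \<le> p" "p \<le> 1"
  shows "expected_queries ans (choose_centers V t p k A W) \<le>
    ennreal (real k * p * real (card V) ^ 2)"
proof (induction k arbitrary: A W)
  case (Suc k)
  let ?n = "card V" and ?c = "ennreal (real k * p * real (card V) ^ 2)"
  let ?R = "\<lambda>S T. bind_alg (dist_table V t (V \<times> T)) (\<lambda>g.
    choose_centers V t p k (A \<union> S) (hit_clusters V (curry g) (A \<union> S) W T))"
  have round: "expected_queries ans (?R S T) \<le> of_nat ?n * of_nat (card T) + ?c" if "T \<subseteq> V" for S T
  proof -
    have "V \<times> T \<subseteq> V \<times> V" using that by blast
    then show ?thesis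
      using computes_dist_table[OF assms(1), of "V \<times> T" ans t] Suc.IH
      by (auto simp: computes_def expected_queries_bind_alg card_cartesian_product intro!: add_mono)
  qed
  have "expected_queries ans (choose_centers V t p (Suc k) A W) =
      (\<integral>\<^sup>+ S. \<integral>\<^sup>+ T. expected_queries ans (?R S T) \<partial>measure_pmf (random_subset p V)
        \<partial>measure_pmf (random_subset (1 / 2 ^ Suc k) W))"
    unfolding choose_centers.simps by (simp add: expected_queries_bind_alg[of _ "draw _"])
  also have "\<dots> \<le> (\<integral>\<^sup>+ S. \<integral>\<^sup>+ T. of_nat ?n * of_nat (card T) + ?c \<partial>measure_pmf (random_subset p V)
        \<partial>measure_pmf (random_subset (1 / 2 ^ Suc k) W))"
    by (intro nn_integral_mono nn_integral_mono_AE)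
      (auto simp: AE_measure_pmf_iff intro!: round dest!: random_subset_subset)
  also have "\<dots> = of_nat ?n * ennreal (p * ?n) + ?c"
    using assms by (simp add: nn_integral_add nn_integral_cmult expected_card_random_subset)
  also have "\<dots> = ennreal (real (Suc k) * p * real ?n ^ 2)"
    using assms(2) by (simp add: ennreal_of_nat_eq_real_of_nat power2_eq_square algebra_simps
        flip: ennreal_mult ennreal_plus)
  finally show ?case .
qed simp

section \<open>Distances in threshold graphs\<close>

lemma path_edges_split: "path_edges (p @ x # q) = path_edges (p @ [x]) @ path_edges (x # q)"
  by (induction p rule: path_edges.induct) auto

lemma path_edges_snoc: "p \<noteq> [] \<Longrightarrow> path_edges (p @ [x]) = path_edges p @ [{last p, x}]"
  by (induction p rule: path_edges.induct) auto

lemma set_path_subset: "p \<noteq> [] \<Longrightarrow> set p \<subseteq> insert (hd p) (\<Union>(set (path_edges p)))"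
  by (induction p rule: path_edges.induct) auto

lemma path_length_nonneg:
  "\<forall>e\<in>F. 0 \<le> w e \<Longrightarrow> set (path_edges p) \<subseteq> F \<Longrightarrow> 0 \<le> path_length w p"
  unfolding path_length_def by (rule sum_list_nonneg) auto

lemma path_extend_by_edge:
  assumes path: "is_path F b u p" and edge: "{u, v} \<in> F" and nonneg: "\<forall>e\<in>F. 0 \<le> w e"
  obtains q where "is_path F b v q" "path_length w q \<le> path_length w p + w {u, v}"
proof (cases "v \<in> set p")
  case True
  then obtain p\<^sub>1 p\<^sub>2 where split: "p = p\<^sub>1 @ v # p\<^sub>2" by (meson split_list)
  then have edges: "path_edges p = path_edges (p\<^sub>1 @ [v]) @ path_edges (v # p\<^sub>2)"
    by (simp only: path_edges_split[of p\<^sub>1 v p\<^sub>2])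
  have "is_path F b v (p\<^sub>1 @ [v])"
    using path edges split by (auto simp: is_path_def hd_append split: if_splits)
  moreover have "path_length w (p\<^sub>1 @ [v]) \<le> path_length w p"
    using path_length_nonneg[OF nonneg, of "v # p\<^sub>2"] path
    by (auto simp: path_length_def edges is_path_def)
  ultimately show ?thesis using that nonneg edge by (auto intro: add_increasing2)
next
  case False
  then have "is_path F b v (p @ [v])" using path edge by (auto simp: is_path_def path_edges_snoc)
  moreover have "path_length w (p @ [v]) = path_length w p + w {u, v}"
    using path by (auto simp: is_path_def path_edges_snoc path_length_def)
  ultimately show ?thesis using that by simp
qed

lemma same_component_refl: "same_component F u u"
  unfolding same_component_def by (intro exI[of _ "[u]"]) (simp add: is_path_def)

lemma same_component_step: "same_component F u v \<Longrightarrow> {v, x} \<in> F \<Longrightarrow> same_component F u x"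
  unfolding same_component_def by (metis path_extend_by_edge[of F u v _ x "\<lambda>_. 0"] order_refl)

lemma same_component_edge: "{u, v} \<in> F \<Longrightarrow> same_component F u v"
  using same_component_refl by (rule same_component_step)

lemma path_edges_rev: "path_edges (rev p) = rev (path_edges p)"
proof (induction p rule: path_edges.induct)
  case (1 x y zs)
  then show ?case
    using path_edges_snoc[of "rev (y # zs)" x] by (simp add: insert_commute)
qed auto

lemma same_component_sym: "same_component F u v \<Longrightarrow> same_component F v u"
  unfolding same_component_def is_path_def
  by (metis Nil_is_rev_conv distinct_rev hd_rev last_rev path_edges_rev set_rev)

lemma same_component_trans:
  assumes "same_component F u v" "same_component F v x"
  shows "same_component F u x"
proof -
  obtain p where "is_path F v x p" using assms(2) by (auto simp: same_component_def)
  then have "p \<noteq> []" "set (path_edges p) \<subseteq> F" "hd p = v" "last p = x" by (auto simp: is_path_def)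
  then show ?thesis using assms(1)
    by (induction p arbitrary: v rule: path_edges.induct) (auto intro: same_component_step)
qed

lemma weighted_dist_le: "is_path F u v p \<Longrightarrow> weighted_dist F w u v \<le> ereal (path_length w p)"
  unfolding weighted_dist_def by (auto intro: INF_lower)

lemma weighted_dist_eq_infinity_iff: "weighted_dist F w u v = \<infinity> \<longleftrightarrow> \<not> same_component F u v"
proof
  assume "weighted_dist F w u v = \<infinity>"
  then show "\<not> same_component F u v"
    using weighted_dist_le[of F u v _ w] by (force simp: same_component_def)
next
  assume "\<not> same_component F u v"
  then have "{p. is_path F u v p} = {}" by (auto simp: same_component_def)
  then show "weighted_dist F w u v = \<infinity>" by (simp add: weighted_dist_def top_ereal_def)
qed

lemma finite_paths:
  assumes "finite (\<Union>F)"
  shows "finite {p. is_path F u v p}"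
proof (rule finite_subset)
  show "{p. is_path F u v p} \<subseteq> {p. set p \<subseteq> insert u (\<Union>F) \<and> distinct p}"
  proof safe
    fix p x assume "is_path F u v p" "x \<in> set p" "x \<notin> \<Union>F"
    then show "x = u" using set_path_subset[of p] unfolding is_path_def by blast
  qed (simp add: is_path_def)
  show "finite {p. set p \<subseteq> insert u (\<Union>F) \<and> distinct p}"
    using assms by (intro finite_subset_distinct) simp
qed

lemma weighted_dist_attained:
  assumes "same_component F u v" "finite (\<Union>F)"
  obtains p where "is_path F u v p" "weighted_dist F w u v = ereal (path_length w p)"
proof -
  have "weighted_dist F w u v \<in> (\<lambda>p. ereal (path_length w p)) ` {p. is_path F u v p}"
    unfolding weighted_dist_def using assms finite_paths[OF assms(2)]
    by (subst Min_Inf[symmetric]) (auto simp: same_component_def intro!: Min_in)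
  then show ?thesis using that by auto
qed

lemma weighted_dist_edge:
  assumes "{u, v} \<in> F" "finite (\<Union>F)" "\<forall>e\<in>F. 0 \<le> w e"
  shows "weighted_dist F w b v \<le> weighted_dist F w b u + ereal (w {u, v})"
proof (cases "same_component F b u")
  case True
  then obtain p where shortest: "is_path F b u p" "weighted_dist F w b u = ereal (path_length w p)"
    using assms(2) by (rule weighted_dist_attained)
  obtain q where extended: "is_path F b v q" "path_length w q \<le> path_length w p + w {u, v}"
    using path_extend_by_edge[OF shortest(1) assms(1,3)] .
  have "weighted_dist F w b v \<le> ereal (path_length w q)" by (rule weighted_dist_le[OF extended(1)])
  also have "\<dots> \<le> weighted_dist F w b u + ereal (w {u, v})" using extended(2) shortest(2) by simp
  finally show ?thesis .
next
  case False
  then have "weighted_dist F w b u = \<infinity>" by (simp add: weighted_dist_eq_infinity_iff)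
  then show ?thesis by simp
qed

lemma is_path_cases [consumes 1, case_names refl edge long]:
  assumes "is_path F u v p"
  obtains "p = [u]" "u = v" | "p = [u, v]" "{u, v} \<in> F" | x y q where "p = u # x # y # q"
  using assms by (cases p rule: remdups_adj.cases)
    (auto simp: is_path_def neq_Nil_conv split: if_splits)

lemma path_length_ge_two_edges:
  assumes "\<forall>e\<in>F. t \<le> w e" "0 \<le> t" "set (path_edges (x # y # z # q)) \<subseteq> F"
  shows "path_length w (z # q) + 2 * t \<le> path_length w (x # y # z # q)"
    and "2 * t \<le> path_length w (x # y # z # q)"
proof -
  have "t \<le> w {x, y}" "t \<le> w {y, z}" using assms(1,3) by auto
  then show "path_length w (z # q) + 2 * t \<le> path_length w (x # y # z # q)"
    by (simp add: path_length_def)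
  moreover have "0 \<le> path_length w (z # q)"
    using assms by (intro path_length_nonneg[of F]) (auto intro: order_trans[of 0 t])
  ultimately show "2 * t \<le> path_length w (x # y # z # q)" by simp
qed

lemma weighted_dist_less_iff:
  assumes "u \<noteq> v" "0 \<le> t" "\<forall>e\<in>F. t \<le> w e"
  shows "weighted_dist F w u v < ereal (2 * t) \<longleftrightarrow> {u, v} \<in> F \<and> w {u, v} < 2 * t"
proof
  assume "weighted_dist F w u v < ereal (2 * t)"
  then obtain p where path: "is_path F u v p" "path_length w p < 2 * t"
    by (auto simp: weighted_dist_def INF_less_iff)
  from path(1) show "{u, v} \<in> F \<and> w {u, v} < 2 * t"
  proof (cases rule: is_path_cases)
    case (long x y q)
    then show ?thesis using path path_length_ge_two_edges(2)[OF assms(3,2), of u x y q]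
      by (simp add: is_path_def)
  qed (use path(2) assms(1) in \<open>auto simp: path_length_def\<close>)
next
  assume light: "{u, v} \<in> F \<and> w {u, v} < 2 * t"
  then have "is_path F u v [u, v]" using assms(1) by (simp add: is_path_def)
  from weighted_dist_le[OF this, of w] show "weighted_dist F w u v < ereal (2 * t)"
    using light by (auto simp: path_length_def elim!: order_le_less_trans)
qed

definition closed_nbhd :: "'v set set \<Rightarrow> 'v set \<Rightarrow> 'v set" where
  "closed_nbhd F U = U \<union> {y. \<exists>x\<in>U. {x, y} \<in> F}"

lemma subset_closed_nbhd: "U \<subseteq> closed_nbhd F U"
  by (auto simp: closed_nbhd_def)

lemma closed_nbhd_mono: "U \<subseteq> U' \<Longrightarrow> closed_nbhd F U \<subseteq> closed_nbhd F U'"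
  by (auto simp: closed_nbhd_def)

lemma closed_nbhd_subset: "\<Union>F \<subseteq> V \<Longrightarrow> U \<subseteq> V \<Longrightarrow> closed_nbhd F U \<subseteq> V"
  by (auto simp: closed_nbhd_def)

lemma vdegree_mono: "finite E \<Longrightarrow> F \<subseteq> E \<Longrightarrow> vdegree F v \<le> vdegree E v"
  unfolding vdegree_def by (intro card_mono) auto

lemma card_neighbours_le:
  assumes "finite F"
  shows "card {y. {x, y} \<in> F} \<le> vdegree F x"
proof -
  have "card {y. {x, y} \<in> F} = card ((\<lambda>y. {x, y}) ` {y. {x, y} \<in> F})"
    by (intro card_image[symmetric] inj_onI) (auto simp: doubleton_eq_iff)
  also have "\<dots> \<le> vdegree F x"
    unfolding vdegree_def using assms by (intro card_mono) auto
  finally show ?thesis .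
qed

lemma card_closed_nbhd_le:
  assumes "finite F" "finite U" "\<forall>x\<in>U. vdegree F x \<le> D"
  shows "card (closed_nbhd F U) \<le> (D + 1) * card U"
proof -
  have "closed_nbhd F U = U \<union> (\<Union>x\<in>U. {y. {x, y} \<in> F})" by (auto simp: closed_nbhd_def)
  then have "card (closed_nbhd F U) \<le> card U + card (\<Union>x\<in>U. {y. {x, y} \<in> F})"
    by (simp add: card_Un_le)
  also have "card (\<Union>x\<in>U. {y. {x, y} \<in> F}) \<le> (\<Sum>x\<in>U. card {y. {x, y} \<in> F})"
    by (rule card_UN_le[OF assms(2)])
  also have "\<dots> \<le> (\<Sum>x\<in>U. D)"
    using assms(3) card_neighbours_le[OF assms(1)] by (intro sum_mono) (meson order_trans)
  finally show ?thesis by (simp add: mult.commute)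
qed

lemma two_edges_towards:
  assumes "same_component F a u" "finite (\<Union>F)" "\<forall>e\<in>F. t \<le> w e" "0 \<le> t" "u \<notin> closed_nbhd F {a}"
  obtains b r where "b \<in> closed_nbhd F (closed_nbhd F {a})"
    "weighted_dist F w b u \<le> ereal r" "ereal (r + 2 * t) \<le> weighted_dist F w a u"
proof -
  obtain p where shortest: "is_path F a u p" "weighted_dist F w a u = ereal (path_length w p)"
    using weighted_dist_attained[OF assms(1,2)] .
  from shortest(1) show ?thesis
  proof (cases rule: is_path_cases)
    case (long x b q)
    have "is_path F b u (b # q)" using shortest(1) long by (auto simp: is_path_def)
    then have "weighted_dist F w b u \<le> ereal (path_length w (b # q))" by (rule weighted_dist_le)
    moreover have "ereal (path_length w (b # q) + 2 * t) \<le> weighted_dist F w a u"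
      using shortest long path_length_ge_two_edges(1)[OF assms(3,4), of a x b q]
      by (simp add: is_path_def)
    moreover have "b \<in> closed_nbhd F (closed_nbhd F {a})"
      using shortest(1) long by (auto simp: is_path_def closed_nbhd_def)
    ultimately show ?thesis using that by blast
  qed (use assms(5) in \<open>auto simp: closed_nbhd_def\<close>)
qed

lemma light_edge_in_cluster:
  assumes "finite (\<Union>F)" "\<Union>F \<subseteq> V" "\<forall>e\<in>F. 0 \<le> w e" "0 < t" "{u, v} \<in> F" "w {u, v} < 2 * t"
    and near: "weighted_dist F w b u \<le> ereal r"
    and far: "\<forall>a\<in>A. ereal (r + 2 * t) \<le> weighted_dist F w a u"
      "\<forall>a\<in>A. ereal (r + 2 * t) \<le> weighted_dist F w a v"
  shows "u \<in> cluster V (weighted_dist F w) A b" "v \<in> cluster V (weighted_dist F w) A b"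
proof -
  have "weighted_dist F w b u < ereal (r + 2 * t)"
    using near assms(4) by (auto elim!: order_le_less_trans)
  then show "u \<in> cluster V (weighted_dist F w) A b"
    using far(1) assms(2,5) by (auto simp: cluster_def intro: less_le_trans)
  have "weighted_dist F w b v \<le> weighted_dist F w b u + ereal (w {u, v})"
    using assms(1,3,5) by (intro weighted_dist_edge)
  also have "\<dots> \<le> ereal r + ereal (w {u, v})" using near by (rule add_right_mono)
  also have "\<dots> < ereal (r + 2 * t)" using assms(6) by simp
  finally show "v \<in> cluster V (weighted_dist F w) A b"
    using far(2) assms(2,5) by (auto simp: cluster_def intro: less_le_trans)
qed

section \<open>Finding the light edges\<close>

primrec component_list :: "nat \<Rightarrow> 'v \<Rightarrow> real \<Rightarrow> 'v list \<Rightarrow> ('v, 'v set) query_alg" where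
  "component_list 0 x t ys =
     Ask (Comp_Query x (set ys) t) (\<lambda>a. Return (if a = 1 then set ys else {}))"
| "component_list (Suc k) x t ys =
     Ask (Comp_Query x (set ys) t) (\<lambda>a. if a = 1 then
       bind_alg (component_list k x t (take (2 ^ k) ys)) (\<lambda>S.
       bind_alg (component_list k x t (drop (2 ^ k) ys)) (\<lambda>S'. Return (S \<union> S')))
     else Return {})"

lemma legal_component_list:
  "x \<in> V \<Longrightarrow> 1 \<le> t \<Longrightarrow> set ys \<subseteq> V - {x} \<Longrightarrow> legal_alg V (component_list k x t ys)"
proof (induction k arbitrary: ys)
  case (Suc k)
  have "set (take (2 ^ k) ys) \<subseteq> V - {x}" "set (drop (2 ^ k) ys) \<subseteq> V - {x}"
    using Suc.prems(3) set_take_subset set_drop_subset by fastforce+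
  then show ?case using Suc by (auto intro!: legal_bind_alg)
qed auto

lemma Collect_set_take_drop:
  assumes "distinct xs"
  shows "{x \<in> set xs. P x} = {x \<in> set (take n xs). P x} \<union> {x \<in> set (drop n xs). P x}"
    and "card {x \<in> set xs. P x} = card {x \<in> set (take n xs). P x} + card {x \<in> set (drop n xs). P x}"
proof -
  have "set xs = set (take n xs) \<union> set (drop n xs)" by (metis append_take_drop_id set_append)
  then show split: "{x \<in> set xs. P x} = {x \<in> set (take n xs). P x} \<union> {x \<in> set (drop n xs). P x}"
    by auto
  have "set (take n xs) \<inter> set (drop n xs) = {}"
    using assms by (rule set_take_disj_set_drop_if_distinct) simp
  then show "card {x \<in> set xs. P x} =
      card {x \<in> set (take n xs). P x} + card {x \<in> set (drop n xs). P x}"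
    unfolding split by (intro card_Un_disjoint) auto
qed

lemma computes_component_list:
  fixes E :: "'v set set" and w :: "'v set \<Rightarrow> real" and t :: real and x :: 'v
  assumes "length ys \<le> 2 ^ k" "distinct ys"
  defines "C \<equiv> \<lambda>ys. {y \<in> set ys. same_component (threshold_edges E w t) x y}"
  shows "computes (answer E w) (component_list k x t ys) (C ys) (1 + 2 * k * card (C ys))"
  using assms(1,2)
proof (induction k arbitrary: ys)
  case 0
  then consider "ys = []" | y where "ys = [y]" by (cases ys) auto
  then show ?case
    by cases (auto simp: C_def computes_def)
next
  case (Suc k)
  let ?ys\<^sub>1 = "take (2 ^ k) ys" and ?ys\<^sub>2 = "drop (2 ^ k) ys"
  show ?case
  proof (cases "C ys = {}")
    case True
    then show ?thesis by (auto simp: C_def computes_def)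
  next
    case False
    have split: "C ys = C ?ys\<^sub>1 \<union> C ?ys\<^sub>2" "card (C ys) = card (C ?ys\<^sub>1) + card (C ?ys\<^sub>2)"
      unfolding C_def by (rule Collect_set_take_drop[OF Suc.prems(2)])+
    have halves: "computes (answer E w) (component_list k x t ?ys\<^sub>1) (C ?ys\<^sub>1)
        (1 + 2 * k * card (C ?ys\<^sub>1))"
      "computes (answer E w) (component_list k x t ?ys\<^sub>2) (C ?ys\<^sub>2)
        (1 + 2 * k * card (C ?ys\<^sub>2))"
      using Suc.prems by (intro Suc.IH; simp)+
    have "computes (answer E w) (bind_alg (component_list k x t ?ys\<^sub>1) (\<lambda>S.
        bind_alg (component_list k x t ?ys\<^sub>2) (\<lambda>S'. Return (S \<union> S')))) (C ys)
        ((1 + 2 * k * card (C ?ys\<^sub>1)) + (1 + 2 * k * card (C ?ys\<^sub>2)))"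
      by (rule computes_bind_alg[OF halves(1) computes_bind_Return[OF halves(2)]])
        (simp add: split(1))
    moreover have "answer E w (Comp_Query x (set ys) t) = 1" using False by (auto simp: C_def)
    ultimately have "computes (answer E w) (component_list (Suc k) x t ys) (C ys)
        (Suc ((1 + 2 * k * card (C ?ys\<^sub>1)) + (1 + 2 * k * card (C ?ys\<^sub>2))))"
      by (auto intro!: computes_Ask simp del: answer.simps)
    moreover have "1 \<le> card (C ys)" using False by (simp add: Suc_le_eq card_gt_0_iff C_def)
    then have "Suc ((1 + 2 * k * card (C ?ys\<^sub>1)) + (1 + 2 * k * card (C ?ys\<^sub>2)))
        \<le> 1 + 2 * Suc k * card (C ys)"
      by (simp add: split(2) algebra_simps)
    ultimately show ?thesis by (rule computes_mono)
  qed
qed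

definition query_nbhd ::
    "'v set \<Rightarrow> real \<Rightarrow> 'v set set \<Rightarrow> 'v set \<Rightarrow> ('v, 'v set) query_alg" where
  "query_nbhd V t H U = bind_alg (dist_table V t (U \<times> V)) (\<lambda>g.
     Return (U \<union> {y \<in> V. \<exists>x\<in>U. {x, y} \<in> H \<or> x \<noteq> y \<and> g (x, y) < ereal (2 * t)}))"

definition query_unreached :: "'v set \<Rightarrow> real \<Rightarrow> 'v set \<Rightarrow> ('v, 'v set) query_alg" where
  "query_unreached V t A = bind_alg (dist_table V t (A \<times> V)) (\<lambda>g.
     Return {x \<in> V. \<forall>a\<in>A. g (a, x) = \<infinity>})"

definition query_cluster_pairs ::
    "'v set \<Rightarrow> real \<Rightarrow> 'v set \<Rightarrow> 'v set \<Rightarrow> ('v, ('v \<times> 'v) set) query_alg" where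
  "query_cluster_pairs V t A N = bind_alg (dist_table V t (N \<times> V)) (\<lambda>g.
     Return (\<Union>b\<in>N. cluster V (curry g) A b \<times> cluster V (curry g) A b))"

definition query_component_pairs ::
    "'v set \<Rightarrow> real \<Rightarrow> nat \<Rightarrow> 'v set \<Rightarrow> ('v, ('v \<times> 'v) set) query_alg" where
  "query_component_pairs V t k Z =
     bind_alg (gather (\<lambda>x. component_list k x t (list_of_set (V - {x}))) (Z \<inter> V))
       (\<lambda>g. Return (Sigma (Z \<inter> V) g))"

definition query_light_edges ::
    "'v set \<Rightarrow> real \<Rightarrow> ('v \<times> 'v) set \<Rightarrow> ('v, 'v set set) query_alg" where
  "query_light_edges V t P = bind_alg (dist_table V t P) (\<lambda>g.
     Return {{x, y} |x y. (x, y) \<in> P \<and> x \<noteq> y \<and> g (x, y) < ereal (2 * t)})"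

text \<open>Here \<open>H\<close> is the set of edges of weight at least \<open>2 * t\<close>, already known from the previous
  layers, \<open>A\<close> is the set of centers, and \<open>Z\<close> consists of the components without a center, which are
  too numerous for distance queries and are enumerated by component queries instead.\<close>

definition add_light_edges ::
    "'v set \<Rightarrow> real \<Rightarrow> nat \<Rightarrow> 'v set set \<Rightarrow> 'v set \<Rightarrow> ('v, 'v set set) query_alg" where
  "add_light_edges V t k H A =
     bind_alg (query_nbhd V t H A) (\<lambda>N\<^sub>1.
     bind_alg (query_nbhd V t H N\<^sub>1) (\<lambda>N.
     bind_alg (query_unreached V t A) (\<lambda>Z.
     bind_alg (query_cluster_pairs V t A N) (\<lambda>Q.
     bind_alg (query_component_pairs V t k Z) (\<lambda>R.
     bind_alg (query_light_edges V t (N \<times> V \<union> Q \<union> R)) (\<lambda>L.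
     Return (H \<union> L)))))))"

lemma legal_add_light_edges:
  assumes "finite V" "1 \<le> t"
  shows "legal_alg V (add_light_edges V t k H A)"
  unfolding add_light_edges_def query_nbhd_def query_unreached_def query_cluster_pairs_def
    query_component_pairs_def query_light_edges_def
  using assms list_of_set[of "V - {_}"]
  by (intro legal_bind_alg legal_dist_table legal_gather legal_component_list) auto

definition light_edges_cost :: "nat \<Rightarrow> nat \<Rightarrow> nat \<Rightarrow> nat \<Rightarrow> nat" where
  "light_edges_cost n k N K = N * (5 * n + K ^ 2) + n * (1 + (2 * k + 1) * K)"

lemma simple_graph_finite_edges: "simple_graph V E \<Longrightarrow> finite E"
  unfolding simple_graph_def by (elim conjE finite_subset) (auto intro: finite_subset[of _ "Pow V"])

locale threshold_layer =
  fixes V :: "'v set" and E :: "'v set set" and w :: "'v set \<Rightarrow> real" and t :: real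
  assumes graph: "simple_graph V E" and t_ge_1: "1 \<le> t"
begin

abbreviation F :: "'v set set" where "F \<equiv> threshold_edges E w t"

abbreviation H :: "'v set set" where "H \<equiv> threshold_edges E w (2 * t)"

abbreviation d :: "'v \<Rightarrow> 'v \<Rightarrow> ereal" where "d \<equiv> weighted_dist F w"

lemma finite_vertices: "finite V"
  using graph by (simp add: simple_graph_def)

lemma finite_F: "finite F"
  using simple_graph_finite_edges[OF graph] by (simp add: threshold_edges_def)

lemma F_subset_E: "F \<subseteq> E"
  by (auto simp: threshold_edges_def)

lemma F_edge: "{x, y} \<in> F \<Longrightarrow> x \<in> V \<and> y \<in> V \<and> x \<noteq> y"
  using graph F_subset_E unfolding simple_graph_def by (auto simp: doubleton_eq_iff)

lemma Union_F_subset: "\<Union>F \<subseteq> V"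
  using graph F_subset_E unfolding simple_graph_def by auto

lemma finite_Union_F: "finite (\<Union>F)"
  using Union_F_subset finite_vertices by (rule finite_subset)

lemma weight_ge: "\<forall>e\<in>F. t \<le> w e"
  by (simp add: threshold_edges_def)

lemma F_iff: "e \<in> F \<longleftrightarrow> e \<in> H \<or> e \<in> F \<and> w e < 2 * t"
  using t_ge_1 by (auto simp: threshold_edges_def)

lemma dist_less_iff: "x \<noteq> y \<Longrightarrow> d x y < ereal (2 * t) \<longleftrightarrow> {x, y} \<in> F \<and> w {x, y} < 2 * t"
  using t_ge_1 weight_ge by (intro weighted_dist_less_iff) auto

lemma computes_bind_dist_table:
  assumes "P \<subseteq> V \<times> V" "h (restrict (\<lambda>(x, y). d x y) P) = r"
  shows "computes (answer E w) (bind_alg (dist_table V t P) (\<lambda>g. Return (h g))) r (card P)"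
  using computes_dist_table[OF finite_vertices assms(1), of "answer E w" t] assms(2)
  by (intro computes_bind_Return[where r = "restrict (\<lambda>(x, y). d x y) P"]) simp_all

lemma computes_query_nbhd:
  assumes "U \<subseteq> V"
  shows "computes (answer E w) (query_nbhd V t H U) (closed_nbhd F U) (card U * card V)"
proof -
  have "{x, y} \<in> H \<or> x \<noteq> y \<and> d x y < ereal (2 * t) \<longleftrightarrow> {x, y} \<in> F" for x y
    using dist_less_iff[of x y] F_iff[of "{x, y}"] F_edge[of x y] by metis
  then have "closed_nbhd F U = U \<union> {y \<in> V. \<exists>x\<in>U. {x, y} \<in> H \<or> x \<noteq> y \<and> d x y < ereal (2 * t)}"
    unfolding closed_nbhd_def using F_edge by blast
  then show ?thesis
    unfolding query_nbhd_def card_cartesian_product[symmetric] using assms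
    by (intro computes_bind_dist_table) auto
qed

definition unreached :: "'v set \<Rightarrow> 'v set" where
  "unreached A = {x \<in> V. \<forall>a\<in>A. d a x = \<infinity>}"

lemma computes_query_unreached:
  assumes "A \<subseteq> V"
  shows "computes (answer E w) (query_unreached V t A) (unreached A)
    (card A * card V)"
  unfolding query_unreached_def unreached_def card_cartesian_product[symmetric] using assms
  by (intro computes_bind_dist_table) auto

lemma computes_query_cluster_pairs:
  assumes "A \<subseteq> N" "N \<subseteq> V"
  shows "computes (answer E w) (query_cluster_pairs V t A N)
    (\<Union>b\<in>N. cluster V d A b \<times> cluster V d A b) (card N * card V)"
  unfolding query_cluster_pairs_def card_cartesian_product[symmetric]
proof (intro computes_bind_dist_table SUP_cong refl)
  show "N \<times> V \<subseteq> V \<times> V" using assms(2) by blast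
  fix b assume "b \<in> N"
  then have "cluster V (curry (restrict (\<lambda>(x, y). d x y) (N \<times> V))) A b = cluster V d A b"
    using assms(1) by (auto simp: cluster_def)
  then show "cluster V (curry (restrict (\<lambda>(x, y). d x y) (N \<times> V))) A b \<times>
      cluster V (curry (restrict (\<lambda>(x, y). d x y) (N \<times> V))) A b =
    cluster V d A b \<times> cluster V d A b" by simp
qed

lemma computes_query_light_edges:
  assumes "P \<subseteq> V \<times> V"
  shows "computes (answer E w) (query_light_edges V t P)
    {{x, y} |x y. (x, y) \<in> P \<and> {x, y} \<in> F \<and> w {x, y} < 2 * t} (card P)"
proof -
  have "x \<noteq> y \<and> d x y < ereal (2 * t) \<longleftrightarrow> {x, y} \<in> F \<and> w {x, y} < 2 * t" for x y
    using dist_less_iff[of x y] F_edge[of x y] by metis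
  then show ?thesis
    unfolding query_light_edges_def
    by (intro computes_bind_dist_table assms Collect_cong ex_cong1) auto
qed

definition component_of :: "'v \<Rightarrow> 'v set" where
  "component_of x = {y \<in> V - {x}. same_component F x y}"

lemma computes_query_component_pairs:
  assumes "Z \<subseteq> V" "card V \<le> 2 ^ k" "\<forall>x\<in>Z. card (component_of x) \<le> K"
  shows "computes (answer E w) (query_component_pairs V t k Z) (Sigma Z component_of)
    (card Z * (1 + 2 * k * K))"
proof -
  have subset: "Z \<inter> V = Z" "finite Z" using assms(1) finite_vertices finite_subset by auto
  have "computes (answer E w) (component_list k x t (list_of_set (V - {x}))) (component_of x)
      (1 + 2 * k * K)" if "x \<in> Z" for x
  proof -
    have others: "set (list_of_set (V - {x})) = V - {x}" "distinct (list_of_set (V - {x}))"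
      using list_of_set[of "V - {x}"] finite_vertices by simp_all
    then have "length (list_of_set (V - {x})) = card (V - {x})" by (metis distinct_card)
    also have "\<dots> \<le> 2 ^ k" using assms(2) card_Diff1_le[of V x] by linarith
    finally have "computes (answer E w) (component_list k x t (list_of_set (V - {x})))
        (component_of x) (1 + 2 * k * card (component_of x))"
      using computes_component_list[where ys = "list_of_set (V - {x})" and x = x and t = t] others
      by (simp add: component_of_def)
    then show ?thesis by (rule computes_mono) (use assms(3) that in simp)
  qed
  with subset(2) have "computes (answer E w)
      (gather (\<lambda>x. component_list k x t (list_of_set (V - {x}))) Z) (restrict component_of Z)
      (\<Sum>x\<in>Z. 1 + 2 * k * K)"
    by (rule computes_gather)
  then have "computes (answer E w) (query_component_pairs V t k Z) (Sigma Z component_of)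
      (\<Sum>x\<in>Z. 1 + 2 * k * K)"
    unfolding query_component_pairs_def subset(1) by (rule computes_bind_Return) auto
  then show ?thesis by simp
qed

lemma component_subset_cluster:
  assumes "x \<in> unreached A"
  shows "component_of x \<subseteq> cluster V d A x"
proof
  fix y assume y: "y \<in> component_of x"
  then have "d x y \<noteq> \<infinity>" by (simp add: component_of_def weighted_dist_eq_infinity_iff)
  moreover have "d a y = \<infinity>" if "a \<in> A" for a
    using that assms y same_component_trans[of F a y x] same_component_sym[of F x y]
    unfolding component_of_def unreached_def mem_Collect_eq weighted_dist_eq_infinity_iff by blast
  ultimately show "y \<in> cluster V d A x" using y by (auto simp: cluster_def component_of_def)
qed

abbreviation two_step_nbhd :: "'v set \<Rightarrow> 'v set" where
  "two_step_nbhd A \<equiv> closed_nbhd F (closed_nbhd F A)"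

lemma light_edge_near_center:
  assumes light: "{u, v} \<in> F" "w {u, v} < 2 * t"
    and nearest: "a \<in> A" "d a u \<noteq> \<infinity>" "\<forall>a'\<in>A. d a u \<le> d a' u" "\<forall>a'\<in>A. d a u \<le> d a' v"
  shows "u \<in> closed_nbhd F A \<or>
    (\<exists>b \<in> two_step_nbhd A. u \<in> cluster V d A b \<and> v \<in> cluster V d A b)"
proof (cases "u \<in> closed_nbhd F {a}")
  case True
  then show ?thesis using closed_nbhd_mono[of "{a}" A F] nearest(1) by auto
next
  case False
  have "same_component F a u" using nearest(2) by (simp add: weighted_dist_eq_infinity_iff)
  then obtain b r where two_steps: "b \<in> closed_nbhd F (closed_nbhd F {a})"
    and gain: "d b u \<le> ereal r" "ereal (r + 2 * t) \<le> d a u"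
    using two_edges_towards[of F a u t w] finite_Union_F weight_ge t_ge_1 False by auto
  have "b \<in> two_step_nbhd A"
    using two_steps nearest(1) closed_nbhd_mono[OF closed_nbhd_mono[of "{a}" A F]] by blast
  moreover have "u \<in> cluster V d A b" "v \<in> cluster V d A b"
    using light_edge_in_cluster[OF finite_Union_F Union_F_subset _ _ light gain(1), of A]
      weight_ge t_ge_1 nearest(3,4) gain(2) by (force intro: order_trans)+
  ultimately show ?thesis by blast
qed

definition candidates :: "'v set \<Rightarrow> ('v \<times> 'v) set" where
  "candidates A =
     two_step_nbhd A \<times> V \<union>
     (\<Union>b\<in>two_step_nbhd A. cluster V d A b \<times> cluster V d A b) \<union>
     Sigma (unreached A) component_of"

lemma unreached_edge_candidate:
  assumes "{u, v} \<in> F" "\<forall>a\<in>A. d a u = \<infinity>"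
  shows "(u, v) \<in> candidates A"
  using assms F_edge[OF assms(1)] same_component_edge[OF assms(1)]
  by (auto simp: candidates_def component_of_def unreached_def)

lemma light_edge_candidate:
  assumes "A \<subseteq> V" and light: "{u, v} \<in> F" "w {u, v} < 2 * t"
  shows "(u, v) \<in> candidates A \<or> (v, u) \<in> candidates A"
proof (cases "A = {}")
  case True
  then show ?thesis using unreached_edge_candidate[OF light(1)] by blast
next
  case False
  let ?S = "A \<times> {u, v}"
  have finite: "finite ?S" "?S \<noteq> {}" using assms(1) False finite_vertices finite_subset by auto
  obtain a z where argmin: "arg_min_on (case_prod d) ?S = (a, z)" by (meson surj_pair)
  have minimizer: "a \<in> A" "z \<in> {u, v}"
    using arg_min_if_finite(1)[OF finite, of "case_prod d"] unfolding argmin by auto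
  have least: "d a z \<le> d a' z'" if "a' \<in> A" "z' \<in> {u, v}" for a' z'
    using arg_min_least[OF finite, of "(a', z')" "case_prod d"] that unfolding argmin by simp
  obtain y where endpoints: "{z, y} = {u, v}" using minimizer(2) by auto
  have "(z, y) \<in> candidates A"
  proof (cases "d a z = \<infinity>")
    case True
    then have "\<forall>a'\<in>A. d a' z = \<infinity>" using least[of _ z] minimizer(2) by auto
    then show ?thesis using light(1) endpoints by (intro unreached_edge_candidate) auto
  next
    case False
    then have "z \<in> closed_nbhd F A \<or>
        (\<exists>b \<in> two_step_nbhd A. z \<in> cluster V d A b \<and> y \<in> cluster V d A b)"
      using light minimizer least endpoints by (intro light_edge_near_center[of z y a A]) auto
    moreover have "y \<in> V" using F_edge[of z y] light(1) endpoints by simp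
    ultimately show ?thesis
      using subset_closed_nbhd[of "closed_nbhd F A" F] by (auto simp: candidates_def)
  qed
  then show ?thesis using endpoints by (auto simp: doubleton_eq_iff)
qed

lemma two_step_nbhd_subset: "A \<subseteq> V \<Longrightarrow> two_step_nbhd A \<subseteq> V"
  using Union_F_subset by (intro closed_nbhd_subset)

lemma card_two_step_nbhd_le:
  assumes "A \<subseteq> V" "\<forall>v\<in>V. vdegree E v \<le> D"
  shows "card (two_step_nbhd A) \<le> (D + 1) ^ 2 * card A"
proof -
  have nbhd: "card (closed_nbhd F U) \<le> (D + 1) * card U" if "U \<subseteq> V" for U
  proof (rule card_closed_nbhd_le[OF finite_F])
    show "finite U" using that finite_vertices by (rule finite_subset)
    show "\<forall>x\<in>U. vdegree F x \<le> D"
      using that assms(2) vdegree_mono[OF simple_graph_finite_edges[OF graph] F_subset_E]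
      by (meson order_trans subsetD)
  qed
  have "card (two_step_nbhd A) \<le> (D + 1) * card (closed_nbhd F A)"
    using assms(1) Union_F_subset by (intro nbhd closed_nbhd_subset)
  also have "\<dots> \<le> (D + 1) * ((D + 1) * card A)"
    using nbhd[OF assms(1)] by (rule mult_le_mono2)
  finally show ?thesis by (simp only: power2_eq_square mult.assoc)
qed

lemma card_component_le:
  assumes "x \<in> unreached A" "\<forall>b\<in>V. card (cluster V d A b) \<le> K"
  shows "card (component_of x) \<le> K"
proof -
  have "card (component_of x) \<le> card (cluster V d A x)"
    using component_subset_cluster[OF assms(1)] finite_subset[OF cluster_subset finite_vertices]
    by (intro card_mono)
  also have "\<dots> \<le> K" using assms by (simp add: unreached_def)
  finally show ?thesis .
qed

lemma card_unreached_le: "card (unreached A) \<le> card V"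
  using finite_vertices by (intro card_mono) (auto simp: unreached_def)

lemma candidates_subset:
  assumes "A \<subseteq> V"
  shows "candidates A \<subseteq> V \<times> V"
proof -
  have "cluster V d A b \<times> cluster V d A b \<subseteq> V \<times> V" for b
    by (intro Sigma_mono cluster_subset)
  then show ?thesis
    unfolding candidates_def using two_step_nbhd_subset[OF assms]
    by (intro Un_least UN_least) (auto simp: unreached_def component_of_def)
qed

lemma card_candidates_le:
  assumes "A \<subseteq> V" and small: "\<forall>b\<in>V. card (cluster V d A b) \<le> K"
  shows "card (candidates A) \<le> card (two_step_nbhd A) * (card V + K ^ 2) + card V * K"
proof -
  let ?N = "two_step_nbhd A"
  have nbhd: "?N \<subseteq> V" "finite ?N"
    using two_step_nbhd_subset[OF assms(1)] finite_vertices finite_subset by auto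
  have "card (\<Union>b\<in>?N. cluster V d A b \<times> cluster V d A b)
      \<le> (\<Sum>b\<in>?N. card (cluster V d A b \<times> cluster V d A b))"
    by (rule card_UN_le[OF nbhd(2)])
  also have "\<dots> \<le> (\<Sum>b\<in>?N. K ^ 2)"
    using small nbhd(1) by (intro sum_mono) (auto simp: card_cartesian_product power2_eq_square
        intro!: mult_le_mono)
  finally have clusters: "card (\<Union>b\<in>?N. cluster V d A b \<times> cluster V d A b) \<le> card ?N * K ^ 2"
    by simp
  have "card (Sigma (unreached A) component_of) = (\<Sum>x\<in>unreached A. card (component_of x))"
    using finite_vertices by (intro card_SigmaI) (auto simp: unreached_def component_of_def)
  also have "\<dots> \<le> (\<Sum>x\<in>unreached A. K)"
    using card_component_le[OF _ small] by (rule sum_mono)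
  also have "\<dots> \<le> card V * K" using card_unreached_le by simp
  finally have components: "card (Sigma (unreached A) component_of) \<le> card V * K" .
  have "card (candidates A) \<le> card (?N \<times> V) +
      card (\<Union>b\<in>?N. cluster V d A b \<times> cluster V d A b) + card (Sigma (unreached A) component_of)"
    unfolding candidates_def by (meson add_le_mono card_Un_le le_trans order_refl)
  then show ?thesis
    using clusters components by (simp add: card_cartesian_product distrib_left)
qed

lemma H_union_light_candidates:
  assumes "A \<subseteq> V"
  shows "H \<union> {{x, y} |x y. (x, y) \<in> candidates A \<and> {x, y} \<in> F \<and> w {x, y} < 2 * t} = F"
    (is "H \<union> ?L = F")
proof
  show "H \<union> ?L \<subseteq> F" using F_iff by blast
  show "F \<subseteq> H \<union> ?L"
  proof
    fix e assume edge: "e \<in> F"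
    then obtain u v where endpoints: "e = {u, v}"
      using graph F_subset_E unfolding simple_graph_def by blast
    show "e \<in> H \<union> ?L"
    proof (cases "e \<in> H")
      case False
      then have light: "{u, v} \<in> F" "w {u, v} < 2 * t" using edge F_iff[of e] endpoints by auto
      have swap: "{v, u} = {u, v}" by (rule insert_commute)
      have "{u, v} \<in> ?L"
        using light_edge_candidate[OF assms light]
      proof
        assume "(u, v) \<in> candidates A"
        then show ?thesis using light by blast
      next
        assume "(v, u) \<in> candidates A"
        then show ?thesis using light swap by (intro CollectI exI[of _ v] exI[of _ u]) simp
      qed
      then show ?thesis using endpoints by simp
    qed simp
  qed
qed

lemma add_light_edges_cost_le:
  assumes "A \<subseteq> V" "\<forall>b\<in>V. card (cluster V d A b) \<le> K"
  shows "card A * card V + (card (closed_nbhd F A) * card V + (card A * card V +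
      (card (two_step_nbhd A) * card V +
        (card (unreached A) * (1 + 2 * k * K) + card (candidates A)))))
    \<le> light_edges_cost (card V) k (card (two_step_nbhd A)) K"
proof -
  let ?n = "card V" and ?N = "two_step_nbhd A"
  have "finite ?N"
    using two_step_nbhd_subset[OF assms(1)] finite_vertices by (rule finite_subset)
  then have "card A \<le> card ?N" "card (closed_nbhd F A) \<le> card ?N"
    using subset_closed_nbhd[of A F] subset_closed_nbhd[of "closed_nbhd F A" F]
    by (auto intro!: card_mono)
  then have "card A * ?n + (card (closed_nbhd F A) * ?n + (card A * ?n + (card ?N * ?n +
      (card (unreached A) * (1 + 2 * k * K) + card (candidates A)))))
    \<le> card ?N * ?n + (card ?N * ?n + (card ?N * ?n + (card ?N * ?n +
      (?n * (1 + 2 * k * K) + (card ?N * (?n + K ^ 2) + ?n * K)))))"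
    using card_candidates_le[OF assms] card_unreached_le
    by (intro add_mono mult_le_mono1 order_refl)
  also have "\<dots> = light_edges_cost ?n k (card ?N) K"
    by (simp add: light_edges_cost_def algebra_simps)
  finally show ?thesis .
qed

lemma computes_add_light_edges:
  assumes "A \<subseteq> V" "card V \<le> 2 ^ k" "\<forall>b\<in>V. card (cluster V d A b) \<le> K"
  shows "computes (answer E w) (add_light_edges V t k H A) F
    (light_edges_cost (card V) k (card (two_step_nbhd A)) K)"
proof (rule computes_mono)
  let ?n = "card V" and ?N = "two_step_nbhd A" and ?N\<^sub>1 = "closed_nbhd F A"
  let ?L = "{{x, y} |x y. (x, y) \<in> candidates A \<and> {x, y} \<in> F \<and> w {x, y} < 2 * t}"
  have sub: "A \<subseteq> ?N" "?N\<^sub>1 \<subseteq> ?N" "?N\<^sub>1 \<subseteq> V" "?N \<subseteq> V"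
    using subset_closed_nbhd closed_nbhd_subset[OF Union_F_subset assms(1)]
      two_step_nbhd_subset[OF assms(1)] order_trans[OF subset_closed_nbhd subset_closed_nbhd]
    by simp_all
  have "computes (answer E w) (query_light_edges V t (?N \<times> V \<union>
      (\<Union>b\<in>?N. cluster V d A b \<times> cluster V d A b) \<union> Sigma (unreached A) component_of)) ?L
      (card (candidates A))"
    using computes_query_light_edges[OF candidates_subset[OF assms(1)]]
    by (simp only: candidates_def)
  then have light: "computes (answer E w) (bind_alg (query_light_edges V t (?N \<times> V \<union>
      (\<Union>b\<in>?N. cluster V d A b \<times> cluster V d A b) \<union> Sigma (unreached A) component_of))
      (\<lambda>L. Return (H \<union> L))) F (card (candidates A))"
    using H_union_light_candidates[OF assms(1)] by (rule computes_bind_Return)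
  have components: "computes (answer E w) (query_component_pairs V t k (unreached A))
      (Sigma (unreached A) component_of) (card (unreached A) * (1 + 2 * k * K))"
    using assms(2) card_component_le[OF _ assms(3)]
    by (intro computes_query_component_pairs) (simp_all add: unreached_def)
  show "computes (answer E w) (add_light_edges V t k H A) F
      (card A * ?n + (card ?N\<^sub>1 * ?n + (card A * ?n + (card ?N * ?n +
        (card (unreached A) * (1 + 2 * k * K) + card (candidates A))))))"
    unfolding add_light_edges_def
    by (rule computes_bind_alg[OF computes_query_nbhd[OF assms(1)]],
        rule computes_bind_alg[OF computes_query_nbhd[OF sub(3)]],
        rule computes_bind_alg[OF computes_query_unreached[OF assms(1)]],
        rule computes_bind_alg[OF computes_query_cluster_pairs[OF sub(1,4)]],
        rule computes_bind_alg[OF components], rule light)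
qed (rule add_light_edges_cost_le[OF assms(1,3)])

lemma light_edges_cost_mono: "N \<le> N' \<Longrightarrow> light_edges_cost n k N K \<le> light_edges_cost n k N' K"
  by (simp add: light_edges_cost_def)

lemma light_edges_cost_mult:
  "light_edges_cost n k (a * N) K = a * (5 * n + K ^ 2) * N + light_edges_cost n k 0 K"
  by (simp add: light_edges_cost_def algebra_simps)

lemma expected_queries_add_light_edges_le:
  assumes centers: "A \<subseteq> V" and size: "card V \<le> 2 ^ k" and degree: "\<forall>v\<in>V. vdegree E v \<le> D"
  shows "expected_queries (answer E w) (add_light_edges V t k H A) \<le>
    of_nat ((D + 1) ^ 2 * (5 * card V + K ^ 2)) * of_nat (card A) +
    of_nat (light_edges_cost (card V) k 0 K) +
    of_nat (light_edges_cost (card V) k (card V) (card V)) *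
      indicator {A. \<exists>b\<in>V. K < card (cluster V d A b)} A"
proof -
  have cost: "expected_queries (answer E w) (add_light_edges V t k H A)
      \<le> of_nat (light_edges_cost (card V) k N K')"
    if "\<forall>b\<in>V. card (cluster V d A b) \<le> K'" "card (two_step_nbhd A) \<le> N" for N K'
  proof -
    have "computes (answer E w) (add_light_edges V t k H A) F (light_edges_cost (card V) k N K')"
      using computes_add_light_edges[OF centers size that(1)] light_edges_cost_mono[OF that(2)]
      by (rule computes_mono)
    then show ?thesis by (simp add: computes_def)
  qed
  show ?thesis
  proof (cases "\<forall>b\<in>V. card (cluster V d A b) \<le> K")
    case True
    show ?thesis
      using cost[OF True card_two_step_nbhd_le[OF centers degree]]
      unfolding light_edges_cost_mult of_nat_add of_nat_mult[where n = "card A"]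
      by (rule add_increasing2[OF zero_le])
  next
    case False
    moreover have "card (two_step_nbhd A) \<le> card V"
      using two_step_nbhd_subset[OF centers] finite_vertices by (intro card_mono)
    then have "expected_queries (answer E w) (add_light_edges V t k H A)
        \<le> of_nat (light_edges_cost (card V) k (card V) (card V))"
      using card_cluster_le[OF finite_vertices] by (intro cost) auto
    ultimately show ?thesis by (auto simp: not_le intro: add_increasing)
  qed
qed

end

section \<open>Cost of a layer\<close>

definition reveal_layer ::
    "'v set \<Rightarrow> nat \<Rightarrow> real \<Rightarrow> 'v set set \<Rightarrow> ('v, 'v set set) query_alg" where
  "reveal_layer V l t H =
     bind_alg (choose_centers V t (1 / 2 ^ l) l {} V) (add_light_edges V t (2 * l) H)"

lemma legal_reveal_layer: "finite V \<Longrightarrow> 1 \<le> t \<Longrightarrow> legal_alg V (reveal_layer V l t H)"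
  unfolding reveal_layer_def
  by (intro legal_bind_alg legal_choose_centers legal_add_light_edges)

context threshold_layer
begin

lemma result_pmf_choose_centers_layer:
  "result_pmf (answer E w) (choose_centers V t p l {} V) = centers_pmf V d p l {} V"
  using result_pmf_choose_centers[OF finite_vertices, of "{}" V "answer E w" t p l] by simp

lemma result_pmf_reveal_layer:
  assumes "card V \<le> 4 ^ l"
  shows "result_pmf (answer E w) (reveal_layer V l t H) = return_pmf F"
proof -
  have "card V \<le> 2 ^ (2 * l)" using assms by (simp add: power_mult)
  then have "result_pmf (answer E w) (add_light_edges V t (2 * l) H A) = return_pmf F"
    if "A \<subseteq> V" for A
    using computes_add_light_edges[OF that] card_cluster_le[OF finite_vertices]
    unfolding computes_def by blast
  then have "result_pmf (answer E w) (reveal_layer V l t H) =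
      bind_pmf (centers_pmf V d (1 / 2 ^ l) l {} V) (\<lambda>A. return_pmf F)"
    unfolding reveal_layer_def result_pmf_bind_alg result_pmf_choose_centers_layer
    by (intro bind_pmf_cong refl) (auto dest!: centers_pmf_subset[rotated 2])
  then show ?thesis by simp
qed

lemma expected_queries_reveal_layer_le_sum:
  fixes l K D :: nat
  assumes "card V \<le> 4 ^ l" "\<forall>v\<in>V. vdegree E v \<le> D"
  defines "n \<equiv> card V" and "p \<equiv> 1 / 2 ^ l"
  shows "expected_queries (answer E w) (reveal_layer V l t H) \<le> ennreal (
    real l * p * real n ^ 2 +
    (real ((D + 1) ^ 2 * (5 * n + K ^ 2)) * (n / 2 ^ l + 2 * real l * p * n) +
     real (light_edges_cost n (2 * l) 0 K) +
     real (light_edges_cost n (2 * l) n n) * (real n * (real l * (1 - p) ^ K))))"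
proof -
  let ?C = "measure_pmf (centers_pmf V d p l {} V)"
  let ?large = "{A. \<exists>b\<in>V. K < card (cluster V d A b)}"
  let ?a = "(D + 1) ^ 2 * (5 * n + K ^ 2)" and ?b = "light_edges_cost n (2 * l) 0 K"
    and ?c = "light_edges_cost n (2 * l) n n"
  have rate: "0 \<le> p" "p \<le> 1" by (simp_all add: p_def)
  have size: "card V \<le> 2 ^ (2 * l)" using assms(1) by (simp add: power_mult)
  have "expected_queries (answer E w) (reveal_layer V l t H) =
      expected_queries (answer E w) (choose_centers V t p l {} V) +
      (\<integral>\<^sup>+ A. expected_queries (answer E w) (add_light_edges V t (2 * l) H A) \<partial>?C)"
    by (simp add: reveal_layer_def expected_queries_bind_alg p_def result_pmf_choose_centers_layer)
  also have "\<dots> \<le> ennreal (real l * p * real n ^ 2) +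
      (\<integral>\<^sup>+ A. of_nat ?a * of_nat (card A) + of_nat ?b + of_nat ?c * indicator ?large A \<partial>?C)"
    unfolding n_def
    by (intro add_mono nn_integral_mono_AE AE_pmfI expected_queries_choose_centers
        finite_vertices rate
        expected_queries_add_light_edges_le[OF _ size assms(2)])
      (rule centers_pmf_subset[of "{}" V V]; simp)
  also have "\<dots> = ennreal (real l * p * real n ^ 2) +
      (of_nat ?a * (\<integral>\<^sup>+ A. of_nat (card A) \<partial>?C) + of_nat ?b + of_nat ?c * emeasure ?C ?large)"
    by (simp add: nn_integral_add nn_integral_cmult del: of_nat_mult of_nat_add)
  also have "\<dots> \<le> ennreal (real l * p * real n ^ 2) +
      (of_nat ?a * ennreal (n / 2 ^ l + 2 * real l * p * n) + of_nat ?b +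
       of_nat ?c * ennreal (real n * (real l * (1 - p) ^ K)))"
    using expected_card_centers_le[OF finite_vertices finite_vertices rate, of d l "{}"]
      emeasure_some_large_cluster_centers_le[OF finite_vertices rate, of d l "{}" K]
    unfolding n_def by (intro add_mono mult_left_mono) simp_all
  finally show ?thesis
    using rate by (simp add: ennreal_of_nat_eq_real_of_nat flip: ennreal_mult ennreal_plus)
qed

end

lemma one_minus_inverse_power_le_half:
  assumes "0 < k"
  shows "(1 - 1 / real k) ^ k \<le> 1 / 2"
proof -
  have "(1 - 1 / real k) ^ k \<le> exp (- (1 / real k)) ^ k"
    using assms exp_ge_add_one_self[of "- (1 / real k)"] by (intro power_mono) auto
  also have "\<dots> = exp (- 1)" using assms by (simp flip: exp_of_nat_mult)
  also have "\<dots> \<le> 1 / 2" using exp_ge_add_one_self[of 1] by (simp add: exp_minus field_simps)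
  finally show ?thesis .
qed

lemma four_power_eq: "(4 :: 'a :: comm_semiring_1) ^ l = (2 ^ l) ^ 2"
  by (simp add: power2_eq_square flip: power_mult_distrib)

lemma eight_power_eq: "(8 :: 'a :: comm_semiring_1) ^ l = 2 ^ l * 4 ^ l"
  by (simp flip: power_mult_distrib)

lemma real_le_square_of_le_four_power:
  assumes "n \<le> 4 ^ l"
  shows "real n \<le> (2 ^ l) ^ 2"
  using of_nat_mono[OF assms, where 'a = real]
  by (simp only: of_nat_power of_nat_numeral four_power_eq)

lemma probe_cost_le:
  fixes n l :: nat
  assumes "n \<le> 4 ^ l"
  shows "real l * (1 / 2 ^ l) * real n ^ 2 \<le> (real l + 1) * 8 ^ l"
proof -
  have "real n ^ 2 \<le> ((2 ^ l) ^ 2) ^ 2"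
    using real_le_square_of_le_four_power[OF assms] by (intro power_mono) simp_all
  also have "\<dots> = 2 ^ l * (8 ^ l :: real)"
    by (simp only: eight_power_eq four_power_eq power2_eq_square mult.assoc)
  finally have "(1 / 2 ^ l) * real n ^ 2 \<le> 8 ^ l" by (simp add: divide_le_eq mult.commute)
  then show ?thesis by (simp only: mult.assoc) (intro mult_mono; simp)
qed

lemma center_count_le:
  fixes n l :: nat
  assumes "n \<le> 4 ^ l"
  shows "n / 2 ^ l + 2 * real l * (1 / 2 ^ l) * n \<le> 2 * (real l + 1) * 2 ^ l"
proof -
  have "real n / 2 ^ l \<le> 2 ^ l"
    using real_le_square_of_le_four_power[OF assms] by (simp add: divide_le_eq power2_eq_square)
  then have "(1 + 2 * real l) * (real n / 2 ^ l) \<le> (2 * (real l + 1)) * 2 ^ l"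
    by (intro mult_mono) auto
  also have "(1 + 2 * real l) * (real n / 2 ^ l) = n / 2 ^ l + 2 * real l * (1 / 2 ^ l) * n"
    by (simp add: field_simps)
  finally show ?thesis .
qed

lemma cost_per_center_le:
  assumes "n \<le> 4 ^ l"
  shows "5 * n + (6 * l * 2 ^ l) ^ 2 \<le> 41 * (l + 1) ^ 2 * 4 ^ l"
proof -
  have "5 * n \<le> 5 * ((l + 1) ^ 2 * 4 ^ l)"
    using assms mult_le_mono[of 1 "(l + 1) ^ 2" n "4 ^ l"] by simp
  moreover have "(6 * l * 2 ^ l) ^ 2 = 36 * (l ^ 2 * 4 ^ l)"
    by (simp only: power_mult_distrib four_power_eq) simp
  moreover have "l ^ 2 * 4 ^ l \<le> (l + 1) ^ 2 * 4 ^ l"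
    by (intro mult_le_mono1 power_mono) auto
  ultimately show ?thesis by linarith
qed

lemma light_edges_cost_component_le:
  assumes "n \<le> 4 ^ l"
  shows "light_edges_cost n (2 * l) 0 (6 * l * 2 ^ l) \<le> 25 * (l + 1) ^ 2 * 8 ^ l"
proof -
  have "1 + (2 * (2 * l) + 1) * (6 * l * 2 ^ l) \<le> (1 + (4 * l + 1) * (6 * l)) * 2 ^ l"
    by (simp add: algebra_simps)
  also have "\<dots> \<le> 25 * (l + 1) ^ 2 * 2 ^ l"
    by (intro mult_le_mono1) (simp add: power2_eq_square algebra_simps)
  finally have "n * (1 + (2 * (2 * l) + 1) * (6 * l * 2 ^ l)) \<le> 4 ^ l * (25 * (l + 1) ^ 2 * 2 ^ l)"
    by (rule mult_le_mono[OF assms])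
  also have "\<dots> = 25 * (l + 1) ^ 2 * 8 ^ l"
    by (simp only: eight_power_eq ac_simps)
  finally show ?thesis by (simp add: light_edges_cost_def)
qed

lemma light_edges_cost_trivial_le:
  "light_edges_cost n (2 * l) n n \<le> 8 * (l + 1) * n ^ 3"
proof -
  have "n \<le> n ^ 3" "n ^ 2 \<le> n ^ 3"
    by (cases n; simp add: self_le_power power_increasing)+
  moreover have "light_edges_cost n (2 * l) n n = n ^ 3 + (4 * l + 6) * n ^ 2 + n"
    by (simp add: light_edges_cost_def power_eq_if algebra_simps)
  moreover have "(4 * l + 6) * n ^ 2 \<le> (4 * l + 6) * n ^ 3"
    using \<open>n ^ 2 \<le> n ^ 3\<close> by (rule mult_le_mono2)
  ultimately show ?thesis by (simp add: algebra_simps)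
qed

lemma overlooked_cluster_cost_le:
  assumes "n \<le> 4 ^ l"
  shows "real (light_edges_cost n (2 * l) n n) *
      (real n * (real l * (1 - 1 / 2 ^ l) ^ (6 * l * 2 ^ l)))
    \<le> 8 * (real l + 1) ^ 2 * 8 ^ l"
proof -
  define M :: real where "M = 2 ^ l"
  have M_ge: "1 \<le> M" by (simp add: M_def)
  have n_le: "real n \<le> M ^ 2" unfolding M_def by (rule real_le_square_of_le_four_power[OF assms])
  have "(1 - 1 / M) ^ 2 ^ l \<le> 1 / 2"
    using one_minus_inverse_power_le_half[of "2 ^ l"] by (simp add: M_def)
  then have "((1 - 1 / M) ^ 2 ^ l) ^ (6 * l) \<le> (1 / 2) ^ (6 * l)"
    using M_ge by (intro power_mono) auto
  moreover have "((1 - 1 / M) ^ 2 ^ l) ^ (6 * l) = (1 - 1 / M) ^ (6 * l * 2 ^ l)"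
    by (simp only: power_mult[symmetric] mult.commute)
  moreover have "(1 / 2) ^ (6 * l) = 1 / M ^ 6"
    unfolding M_def power_one_over power_mult[symmetric] by (simp add: mult.commute)
  ultimately have miss: "(1 - 1 / M) ^ (6 * l * 2 ^ l) \<le> 1 / M ^ 6" by simp
  have "real (light_edges_cost n (2 * l) n n) \<le> 8 * (real l + 1) * real n ^ 3"
    using of_nat_mono[OF light_edges_cost_trivial_le[of n l], where 'a = real]
    by (simp add: add.commute)
  also have "\<dots> \<le> 8 * (real l + 1) * (M ^ 2) ^ 3"
    using n_le by (intro mult_left_mono power_mono) auto
  finally have "real (light_edges_cost n (2 * l) n n) *
      (real n * (real l * (1 - 1 / M) ^ (6 * l * 2 ^ l)))
      \<le> 8 * (real l + 1) * (M ^ 2) ^ 3 * (M ^ 2 * ((real l + 1) * (1 / M ^ 6)))"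
    using n_le miss M_ge by (intro mult_mono) auto
  also have "\<dots> = 8 * (real l + 1) ^ 2 * M ^ 2"
    using M_ge by (simp flip: power_mult) (simp add: power2_eq_square)
  also have "\<dots> \<le> 8 * (real l + 1) ^ 2 * M ^ 3"
    using M_ge by (intro mult_left_mono power_increasing) auto
  also have "M ^ 3 = 8 ^ l"
    by (simp only: M_def eight_power_eq four_power_eq power2_eq_square power3_eq_cube mult.assoc)
  finally show ?thesis by (simp only: M_def)
qed

definition layer_cost :: "nat \<Rightarrow> nat \<Rightarrow> nat" where
  "layer_cost l D = 116 * (l + 1) ^ 3 * (D + 1) ^ 2 * 8 ^ l"

text \<open>The bound \<open>K\<close> on the cluster sizes is chosen such that a cluster exceeding it is overlooked
  with probability at most \<open>l * (1 - p) ^ K \<le> l * 2 ^ (- 6 * l)\<close>, which outweighs the trivial bound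
  \<open>O(l * n ^ 3)\<close> on the number of queries in that case.\<close>

lemma layer_cost_bound:
  assumes "n \<le> 4 ^ l"
  defines "K \<equiv> 6 * l * 2 ^ l" and "p \<equiv> 1 / 2 ^ l"
  shows "real l * p * real n ^ 2 +
    (real ((D + 1) ^ 2 * (5 * n + K ^ 2)) * (n / 2 ^ l + 2 * real l * p * n) +
     real (light_edges_cost n (2 * l) 0 K) +
     real (light_edges_cost n (2 * l) n n) * (real n * (real l * (1 - p) ^ K)))
    \<le> real (layer_cost l D)"
proof -
  define y Q M where "y = real l + 1" and "Q = real ((D + 1) ^ 2)" and "M = (8 ^ l :: real)"
  have y_ge: "1 \<le> y" and Q_ge: "1 \<le> Q" and M_ge: "0 \<le> M" by (simp_all add: y_def Q_def M_def)
  have "real ((D + 1) ^ 2 * (5 * n + K ^ 2)) * (n / 2 ^ l + 2 * real l * p * n)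
      \<le> real ((D + 1) ^ 2 * (41 * (l + 1) ^ 2 * 4 ^ l)) * (2 * (real l + 1) * 2 ^ l)"
    unfolding K_def p_def using assms(1)
    by (intro mult_mono center_count_le of_nat_mono mult_le_mono2 cost_per_center_le) auto
  also have "\<dots> = (Q * (41 * y ^ 2 * 4 ^ l)) * (2 * y * 2 ^ l)"
    by (simp add: y_def Q_def add.commute)
  also have "\<dots> = 82 * (y ^ 3 * Q * M)"
    unfolding M_def eight_power_eq by (simp add: power2_eq_square power3_eq_cube)
  finally have centers: "real ((D + 1) ^ 2 * (5 * n + K ^ 2)) * (n / 2 ^ l + 2 * real l * p * n)
      \<le> 82 * (y ^ 3 * Q * M)" .
  have probes: "real l * p * real n ^ 2 \<le> y * M"
    using probe_cost_le[OF assms(1)] by (simp add: p_def y_def M_def)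
  have components: "real (light_edges_cost n (2 * l) 0 K) \<le> 25 * y ^ 2 * M"
    using of_nat_mono[OF light_edges_cost_component_le[OF assms(1)], where 'a = real]
    by (simp add: K_def y_def M_def add.commute)
  have overlooked: "real (light_edges_cost n (2 * l) n n) * (real n * (real l * (1 - p) ^ K))
      \<le> 8 * y ^ 2 * M"
    using overlooked_cluster_cost_le[OF assms(1)] by (simp add: K_def p_def y_def M_def)
  have "y ^ 1 * 1 \<le> y ^ 3 * Q" "y ^ 2 * 1 \<le> y ^ 3 * Q"
    using y_ge Q_ge by (intro mult_mono power_increasing; simp)+
  then have "y * M \<le> y ^ 3 * Q * M" "y ^ 2 * M \<le> y ^ 3 * Q * M"
    using M_ge by (auto intro: mult_right_mono)
  moreover have "real (layer_cost l D) = 116 * (y ^ 3 * Q * M)"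
    by (simp add: layer_cost_def y_def Q_def M_def add.commute)
  ultimately show ?thesis using centers probes components overlooked by linarith
qed

lemma (in threshold_layer) computes_reveal_layer:
  assumes "card V \<le> 4 ^ l" "\<forall>v\<in>V. vdegree E v \<le> D"
  shows "computes (answer E w) (reveal_layer V l t H) F (layer_cost l D)"
  unfolding computes_def ennreal_of_nat_eq_real_of_nat
  using result_pmf_reveal_layer[OF assms(1)]
    order_trans[OF expected_queries_reveal_layer_le_sum[OF assms]
      ennreal_leI[OF layer_cost_bound[OF assms(1)]]]
  by blast

section \<open>The reconstruction algorithm\<close>

primrec reveal_layers :: "'v set \<Rightarrow> nat \<Rightarrow> nat \<Rightarrow> 'v set set \<Rightarrow> ('v, 'v set set) query_alg" where
  "reveal_layers V l 0 H = Return H"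
| "reveal_layers V l (Suc j) H = bind_alg (reveal_layer V l (2 ^ j) H) (reveal_layers V l j)"

lemma legal_reveal_layers: "finite V \<Longrightarrow> legal_alg V (reveal_layers V l j H)"
  by (induction j arbitrary: H) (auto intro!: legal_bind_alg legal_reveal_layer)

lemma computes_reveal_layers:
  assumes "simple_graph V E" "card V \<le> 4 ^ l" "\<forall>v\<in>V. vdegree E v \<le> D"
  shows "computes (answer E w) (reveal_layers V l j (threshold_edges E w (2 ^ j)))
    (threshold_edges E w 1) (j * layer_cost l D)"
proof (induction j)
  case 0
  then show ?case by (simp add: computes_Return)
next
  case (Suc j)
  interpret threshold_layer V E w "2 ^ j" using assms(1) by unfold_locales simp_all
  have "computes (answer E w) (reveal_layer V l (2 ^ j) (threshold_edges E w (2 ^ Suc j)))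
      (threshold_edges E w (2 ^ j)) (layer_cost l D)"
    using computes_reveal_layer[OF assms(2,3)] by simp
  from computes_bind_alg[where g = "reveal_layers V l j", OF this Suc.IH]
  show ?case by simp
qed

definition endpoints :: "'v set \<Rightarrow> 'v \<times> 'v" where
  "endpoints e = (SOME p. e = {fst p, snd p})"

lemma endpoints: "e = {u, v} \<Longrightarrow> {fst (endpoints e), snd (endpoints e)} = e"
  unfolding endpoints_def by (rule someI2[of _ "(u, v)"]) auto

definition weight_table :: "'v set \<Rightarrow> 'v set set \<Rightarrow> ('v, 'v set \<Rightarrow> ereal) query_alg" where
  "weight_table V E = gather
     (\<lambda>e. Ask (Weight_Query (fst (endpoints e)) (snd (endpoints e)) 1) Return)
     (E \<inter> {{u, v} |u v. u \<in> V \<and> v \<in> V \<and> u \<noteq> v})"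

lemma legal_weight_table:
  assumes "finite V"
  shows "legal_alg V (weight_table V E)"
  unfolding weight_table_def
proof (intro legal_gather)
  have "simple_graph V (E \<inter> {{u, v} |u v. u \<in> V \<and> v \<in> V \<and> u \<noteq> v})"
    using assms by (auto simp: simple_graph_def)
  then show "finite (E \<inter> {{u, v} |u v. u \<in> V \<and> v \<in> V \<and> u \<noteq> v})"
    by (rule simple_graph_finite_edges)
  fix e assume "e \<in> E \<inter> {{u, v} |u v. u \<in> V \<and> v \<in> V \<and> u \<noteq> v}"
  then obtain u v where "e = {u, v}" "u \<in> V" "v \<in> V" by auto
  then show "legal_alg V (Ask (Weight_Query (fst (endpoints e)) (snd (endpoints e)) 1) Return)"
    using endpoints[of e u v] by (auto simp: doubleton_eq_iff)
qed

lemma computes_weight_table: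
  assumes "simple_graph V E" "\<forall>e\<in>E. 1 \<le> w e"
  shows "computes (answer E w) (weight_table V E) (restrict (\<lambda>e. ereal (w e)) E) (card E)"
proof -
  have "E \<inter> {{u, v} |u v. u \<in> V \<and> v \<in> V \<and> u \<noteq> v} = E"
    using assms(1) by (auto simp: simple_graph_def)
  moreover have "computes (answer E w)
      (gather (\<lambda>e. Ask (Weight_Query (fst (endpoints e)) (snd (endpoints e)) 1) Return) E)
      (restrict (\<lambda>e. ereal (w e)) E) (\<Sum>e\<in>E. Suc 0)"
  proof (intro computes_gather simple_graph_finite_edges[OF assms(1)] computes_Ask)
    fix e assume e: "e \<in> E"
    then obtain u v where "e = {u, v}" using assms(1) by (auto simp: simple_graph_def)
    from endpoints[OF this] e assms(2)
    show "computes (answer E w)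
        (Return (answer E w (Weight_Query (fst (endpoints e)) (snd (endpoints e)) 1)))
        (ereal (w e)) 0"
      by (simp add: computes_Return threshold_edges_def)
  qed
  ultimately show ?thesis by (simp add: weight_table_def)
qed

definition center_rounds :: "nat \<Rightarrow> nat" where
  "center_rounds n = nat \<lceil>log 4 n\<rceil>"

lemma le_power_center_rounds: "n \<le> 4 ^ center_rounds n"
proof (cases "n = 0")
  case False
  have "real n = 4 powr log 4 n" using False by simp
  also have "\<dots> \<le> 4 powr real (center_rounds n)"
    by (intro powr_mono) (auto simp: center_rounds_def real_nat_ceiling_ge)
  finally have "real n \<le> real (4 ^ center_rounds n)" by (simp add: powr_realpow)
  then show ?thesis by (simp only: of_nat_le_iff)
qed simp

lemma center_rounds_le:
  assumes "1 \<le> n"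
  shows "real (center_rounds n) \<le> 1 + log 4 n"
proof -
  have "0 \<le> log 4 n" using assms by simp
  then show ?thesis unfolding center_rounds_def by linarith
qed

definition layer_count :: "real \<Rightarrow> nat" where
  "layer_count W = Suc (nat \<lfloor>log 2 W\<rfloor>)"

lemma layer_count_le: "1 \<le> W \<Longrightarrow> real (layer_count W) \<le> 1 + log 2 W"
  by (simp add: layer_count_def)

lemma less_power_layer_count:
  assumes "1 \<le> W"
  shows "W < 2 ^ layer_count W"
proof -
  have "log 2 W < real (layer_count W)"
    using assms by (auto simp: layer_count_def) linarith
  then have "2 powr log 2 W < 2 powr real (layer_count W)" by simp
  then show ?thesis using assms by (simp add: powr_realpow)
qed

definition reconstruct :: "'v set \<Rightarrow> real \<Rightarrow> ('v, 'v set set \<times> ('v set \<Rightarrow> real)) query_alg" where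
  "reconstruct V W =
     bind_alg (reveal_layers V (center_rounds (card V)) (layer_count W) {}) (\<lambda>E.
     bind_alg (weight_table V E) (\<lambda>g. Return (E, restrict (real_of_ereal \<circ> g) E)))"

lemma legal_reconstruct: "finite V \<Longrightarrow> legal_alg V (reconstruct V W)"
  unfolding reconstruct_def
  by (intro legal_bind_alg legal_reveal_layers legal_weight_table) auto

lemma max_weight_ge_one:
  assumes "simple_graph V E" "E \<noteq> {}" "\<forall>e\<in>E. 1 \<le> w e"
  shows "1 \<le> max_weight E w"
  using simple_graph_finite_edges[OF assms(1)] assms(2,3)
  unfolding max_weight_def by (auto simp: Max_ge_iff)

lemma threshold_edges_max_weight_eq_empty:
  assumes "finite E" "max_weight E w < t"
  shows "threshold_edges E w t = {}"
proof -
  have "w e \<le> max_weight E w" if "e \<in> E" for e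
    using that assms(1) by (simp add: max_weight_def)
  then show ?thesis using assms(2) by (force simp: threshold_edges_def)
qed

lemma computes_reconstruct:
  assumes graph: "simple_graph V E" and "E \<noteq> {}" and weights: "\<forall>e\<in>E. 1 \<le> w e"
    and degree: "\<forall>v\<in>V. vdegree E v \<le> D"
  shows "computes (answer E w) (reconstruct V (max_weight E w)) (E, restrict w E)
    (layer_count (max_weight E w) * layer_cost (center_rounds (card V)) D + card E)"
proof -
  let ?J = "layer_count (max_weight E w)"
  have "{} = threshold_edges E w (2 ^ ?J)"
    using threshold_edges_max_weight_eq_empty[OF simple_graph_finite_edges[OF graph]]
      less_power_layer_count[OF max_weight_ge_one[OF assms(1-3)]] by simp
  moreover have "threshold_edges E w 1 = E" using weights by (auto simp: threshold_edges_def)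
  ultimately have layers: "computes (answer E w)
      (reveal_layers V (center_rounds (card V)) ?J {}) E
      (?J * layer_cost (center_rounds (card V)) D)"
    using computes_reveal_layers[OF graph le_power_center_rounds degree, of w ?J] by simp
  have "computes (answer E w)
      (bind_alg (weight_table V E) (\<lambda>g. Return (E, restrict (real_of_ereal \<circ> g) E)))
      (E, restrict w E) (card E)"
    using computes_weight_table[OF graph weights] by (rule computes_bind_Return) auto
  then show ?thesis
    unfolding reconstruct_def by (rule computes_bind_alg[OF layers])
qed

section \<open>Pareto weights\<close>

lemma card_edges_le_square:
  assumes "simple_graph V E"
  shows "card E \<le> card V ^ 2"
proof -
  have finite: "finite V" using assms by (simp add: simple_graph_def)
  have "E \<subseteq> (\<lambda>(u, v). {u, v}) ` (V \<times> V)" using assms by (auto simp: simple_graph_def)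
  then have "card E \<le> card (V \<times> V)" using finite by (intro surj_card_le) auto
  then show ?thesis by (simp add: card_cartesian_product power2_eq_square)
qed

lemma card_edges_le_degree:
  assumes "simple_graph V E" "\<forall>v\<in>V. vdegree E v \<le> D"
  shows "card E \<le> card V * D"
proof -
  have finite: "finite V" using assms by (simp add: simple_graph_def)
  have incident: "E = (\<Union>v\<in>V. {e \<in> E. v \<in> e})" using assms(1) by (auto simp: simple_graph_def)
  have "card E \<le> (\<Sum>v\<in>V. vdegree E v)"
    using card_UN_le[OF finite, of "\<lambda>v. {e \<in> E. v \<in> e}"] unfolding vdegree_def incident[symmetric] .
  also have "\<dots> \<le> (\<Sum>v\<in>V. D)" using assms(2) by (intro sum_mono) auto
  finally show ?thesis by simp
qed

lemma (in real_distribution) pareto_measure_Icc: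
  assumes "cdf M = pareto_cdf \<alpha>" "1 \<le> c"
  shows "measure M {1..c} = 1 - c powr (- \<alpha>)"
proof -
  have "eventually (\<lambda>x. cdf M x = 0) (at_left 1)"
    using assms(1) eventually_at_left_field[of _ "1 :: real"]
    by (auto simp: pareto_cdf_def intro!: exI[of _ 0])
  then have "(cdf M \<longlongrightarrow> 0) (at_left 1)" by (rule tendsto_eventually)
  then have below: "measure M {..<1} = 0"
    by (intro tendsto_unique[OF _ cdf_at_left]) simp_all
  have "{..c} = {..<1} \<union> {1..c}" using assms(2) by auto
  then have "measure M {..c} = measure M {..<1} + measure M {1..c}"
    by (simp add: finite_measure_Union disjoint_iff)
  then show ?thesis
    using below assms by (simp add: cdf_def2[symmetric] pareto_cdf_def)
qed

lemma prob_pareto_weight_outside: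
  assumes iid: "iid_pareto_weights M \<alpha> E X" and "e \<in> E" "1 \<le> c"
  shows "measure M {\<omega> \<in> space M. X e \<omega> \<notin> {1..c}} = c powr (- \<alpha>)"
proof -
  interpret prob_space M using iid by (simp add: iid_pareto_weights_def)
  have weight [measurable]: "X e \<in> borel_measurable M"
    using iid assms(2) by (auto simp: iid_pareto_weights_def indep_vars_def)
  interpret N: real_distribution "distr M borel (X e)"
    using weight by (rule real_distribution_distr)
  have "cdf (distr M borel (X e)) = pareto_cdf \<alpha>"
    using iid assms(2) by (simp add: iid_pareto_weights_def)
  then have "prob {\<omega> \<in> space M. X e \<omega> \<in> {1..c}} = 1 - c powr (- \<alpha>)"
    using N.pareto_measure_Icc[OF _ assms(3)]
    by (simp add: measure_distr vimage_def Int_def conj_commute)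
  moreover have "{\<omega> \<in> space M. X e \<omega> \<notin> {1..c}} = space M - {\<omega> \<in> space M. X e \<omega> \<in> {1..c}}"
    by auto
  moreover have "{\<omega> \<in> space M. X e \<omega> \<in> {1..c}} \<in> events" by measurable
  ultimately show ?thesis by (simp add: prob_compl del: atLeastAtMost_iff)
qed

lemma prob_pareto_weights_bounded:
  assumes iid: "iid_pareto_weights M \<alpha> E X" and "finite E" "1 \<le> c"
  defines "G \<equiv> {\<omega> \<in> space M. \<forall>e\<in>E. X e \<omega> \<in> {1..c}}"
  shows "G \<in> sets M" and "1 - card E * c powr (- \<alpha>) \<le> measure M G"
proof -
  interpret prob_space M using iid by (simp add: iid_pareto_weights_def)
  have weight [measurable]: "X e \<in> borel_measurable M" if "e \<in> E" for e
    using iid that by (auto simp: iid_pareto_weights_def indep_vars_def)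
  show measurable: "G \<in> sets M"
    unfolding G_def using weight assms(2) by measurable
  have "space M - G = (\<Union>e\<in>E. {\<omega> \<in> space M. X e \<omega> \<notin> {1..c}})"
    unfolding G_def by blast
  then have "prob (space M - G) \<le> (\<Sum>e\<in>E. prob {\<omega> \<in> space M. X e \<omega> \<notin> {1..c}})"
    using weight assms(2) by (auto intro!: finite_measure_subadditive_finite)
  also have "\<dots> = card E * c powr (- \<alpha>)"
    using prob_pareto_weight_outside[OF iid _ assms(3)] by simp
  finally show "1 - card E * c powr (- \<alpha>) \<le> prob G" using prob_compl[OF measurable] by simp
qed

definition moderate_weights ::
    "'a measure \<Rightarrow> real \<Rightarrow> 'v set set \<Rightarrow> ('v set \<Rightarrow> 'a \<Rightarrow> real) \<Rightarrow> 'a set" where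
  "moderate_weights M \<alpha> E X =
     {\<omega> \<in> space M. \<forall>e\<in>E. X e \<omega> \<in> {1..real (card E) powr (2 / \<alpha>)}}"

lemma prob_moderate_weights:
  assumes "iid_pareto_weights M \<alpha> E X" "0 < \<alpha>" "finite E" "E \<noteq> {}"
  shows "moderate_weights M \<alpha> E X \<in> sets M"
    and "1 - 1 / real (card E) \<le> measure M (moderate_weights M \<alpha> E X)"
proof -
  let ?c = "real (card E) powr (2 / \<alpha>)"
  have card: "1 \<le> real (card E)" using assms(3,4) by (simp add: Suc_le_eq card_gt_0_iff)
  then have "1 \<le> ?c" using assms(2) by (simp add: ge_one_powr_ge_zero)
  note bounded = prob_pareto_weights_bounded[OF assms(1,3) this]
  show "moderate_weights M \<alpha> E X \<in> sets M"
    unfolding moderate_weights_def by (rule bounded)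
  have "?c powr (- \<alpha>) = 1 / real (card E) ^ 2"
    using assms(2) card by (simp add: powr_powr powr_minus_divide powr_realpow)
  then have "card E * ?c powr (- \<alpha>) = 1 / real (card E)" by (simp add: power2_eq_square)
  then show "1 - 1 / real (card E) \<le> measure M (moderate_weights M \<alpha> E X)"
    using bounded(2) unfolding moderate_weights_def by simp
qed

lemma one_le_ln:
  assumes "3 \<le> k"
  shows "1 \<le> ln (real k)"
  using assms exp_le by (subst ln_ge_iff) (auto intro: order_trans)

lemma layer_count_powr_le:
  fixes m n D :: nat and W \<alpha> :: real
  assumes "0 < \<alpha>" "1 \<le> W" "W \<le> real m powr (2 / \<alpha>)" "1 \<le> m" "m \<le> n ^ 2" "3 \<le> n" "3 \<le> D"
  shows "real (layer_count W) \<le> 8 * ln n * (1 + 1 / \<alpha> * ln D)"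
proof -
  have ln_ge: "1 \<le> ln (real n)" "1 \<le> ln (real D)" using assms(6,7) by (simp_all add: one_le_ln)
  have "ln (real m) \<le> ln (real n ^ 2)"
    using assms(4-6) by (subst ln_le_cancel_iff) (auto simp flip: of_nat_power)
  then have "ln (real m) \<le> 2 * ln n" using assms(6) by (simp add: ln_realpow)
  then have "2 / \<alpha> * ln m \<le> 2 / \<alpha> * (2 * ln n)" using assms(1) by (intro mult_left_mono) auto
  moreover have "ln W \<le> 2 / \<alpha> * ln m"
    using assms(1-4) ln_le_cancel_iff[of W "real m powr (2 / \<alpha>)"] by (simp add: ln_powr)
  ultimately have lnW: "ln W \<le> 4 * (1 / \<alpha>) * ln n" by simp
  have "1 / 2 \<le> ln (2 :: real)"
    using ln_le_minus_one[of "1 / 2 :: real"] by (simp add: ln_div)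
  then have "ln W \<le> 2 * ln W * ln 2"
    using assms(2) mult_left_mono[of "1 / 2" "ln 2" "2 * ln W"] by simp
  then have "log 2 W \<le> 2 * ln W" by (simp add: log_def divide_le_eq)
  with lnW have "real (layer_count W) \<le> 1 + 8 * (1 / \<alpha>) * ln n"
    using layer_count_le[OF assms(2)] by linarith
  also have "\<dots> \<le> 8 * ln n + 8 * (1 / \<alpha> * ln D) * ln n"
    using ln_ge assms(1)
    by (intro add_mono mult_right_mono mult_left_mono) (auto simp: divide_right_mono)
  finally show ?thesis by (simp add: algebra_simps)
qed

lemma center_rounds_le_ln:
  assumes "3 \<le> n"
  shows "real (center_rounds n) + 1 \<le> 3 * ln n"
proof -
  have "1 \<le> ln (4 :: real)" "1 \<le> ln (real n)" using one_le_ln[of 4] one_le_ln[OF assms] by simp_all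
  then have "log 4 n \<le> ln n" by (simp add: log_def divide_le_eq mult_le_cancel_left1)
  then show ?thesis using center_rounds_le[of n] assms \<open>1 \<le> ln (real n)\<close> by linarith
qed

lemma eight_power_center_rounds_le:
  assumes "1 \<le> n"
  shows "8 ^ center_rounds n \<le> 8 * real n powr (3 / 2)"
proof -
  have "(4 :: real) powr (3 / 2) = (2 powr 2) powr (3 / 2)" by (simp add: powr_numeral)
  also have "\<dots> = 8" by (simp only: powr_powr) (simp add: powr_numeral)
  finally have eight: "(4 :: real) powr (3 / 2) = 8" .
  have "(4 :: real) powr center_rounds n \<le> 4 powr (1 + log 4 n)"
    using center_rounds_le[OF assms] by (rule powr_mono) simp
  also have "\<dots> = 4 * real n" using assms by (simp add: powr_add)
  finally have four: "(4 :: real) powr center_rounds n \<le> 4 * real n" .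
  have "(8 :: real) ^ center_rounds n = (4 powr (3 / 2)) powr center_rounds n"
    by (simp add: eight powr_realpow)
  also have "\<dots> = (4 powr center_rounds n) powr (3 / 2)" by (simp only: powr_powr mult.commute)
  also have "\<dots> \<le> (4 * real n) powr (3 / 2)" using four by (intro powr_mono2) auto
  also have "\<dots> = 8 * real n powr (3 / 2)" by (simp only: powr_mult eight)
  finally show ?thesis .
qed

lemma layer_cost_center_rounds_le:
  assumes "3 \<le> n" "3 \<le> D"
  shows "real (layer_cost (center_rounds n) D) \<le>
    100224 * ln n ^ 3 * (real D ^ 3 * real n powr (3 / 2))"
proof -
  have "real D + 1 \<le> 2 * real D" using assms(2) by simp
  then have "(real D + 1) ^ 2 \<le> (2 * real D) ^ 2" by (intro power_mono) auto
  also have "\<dots> \<le> 4 * real D ^ 3" using assms(2) by (simp add: power2_eq_square power3_eq_cube)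
  finally have degree: "(real D + 1) ^ 2 \<le> 4 * real D ^ 3" .
  have "real (layer_cost (center_rounds n) D) =
      116 * (real (center_rounds n) + 1) ^ 3 * (real D + 1) ^ 2 * 8 ^ center_rounds n"
    by (simp add: layer_cost_def add.commute)
  also have "\<dots> \<le> 116 * (3 * ln n) ^ 3 * (4 * real D ^ 3) * (8 * real n powr (3 / 2))"
    using degree center_rounds_le_ln[OF assms(1)] eight_power_center_rounds_le[of n] assms(1)
    by (intro mult_mono power_mono) auto
  also have "\<dots> = 100224 * ln n ^ 3 * (real D ^ 3 * real n powr (3 / 2))"
    by (simp add: power_mult_distrib)
  finally show ?thesis .
qed

lemma reconstruct_cost_le:
  fixes m n D :: nat and W \<alpha> :: real
  assumes "0 < \<alpha>" "1 \<le> W" "W \<le> real m powr (2 / \<alpha>)" "1 \<le> m" "m \<le> n ^ 2" "m \<le> n * D"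
    "3 \<le> n" "3 \<le> D"
  shows "real (layer_count W * layer_cost (center_rounds n) D + m) \<le>
    801793 * ln n ^ 4 * ((1 + 1 / \<alpha> * ln D) * real D ^ 3 * real n powr (3 / 2))"
proof -
  define L where "L = ln (real n)"
  define y where "y = 1 + 1 / \<alpha> * ln D"
  define z where "z = real D ^ 3 * real n powr (3 / 2)"
  have L_ge: "1 \<le> L" unfolding L_def by (rule one_le_ln[OF assms(7)])
  have y_ge: "1 \<le> y" using assms(1) one_le_ln[OF assms(8)] by (simp add: y_def)
  have "real (layer_count W * layer_cost (center_rounds n) D) \<le> (8 * L * y) * (100224 * L ^ 3 * z)"
    unfolding of_nat_mult L_def y_def z_def using L_ge y_ge assms
    by (intro mult_mono layer_count_powr_le layer_cost_center_rounds_le) (auto simp: L_def y_def)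
  also have "\<dots> = 801792 * (L ^ 4 * (y * z))" by (simp add: power_eq_if)
  finally have layers: "real (layer_count W * layer_cost (center_rounds n) D)
      \<le> 801792 * (L ^ 4 * (y * z))" .
  have "real m \<le> real D * real n"
    using of_nat_mono[OF assms(6), where 'a = real] by (simp add: mult.commute)
  also have "\<dots> \<le> z"
    unfolding z_def using assms(7,8) self_le_power[of "real D" 3] powr_mono[of 1 "3 / 2" "real n"]
    by (intro mult_mono) auto
  also have "1 * (1 * z) \<le> L ^ 4 * (y * z)"
    using L_ge y_ge by (intro mult_mono one_le_power) (auto simp: z_def)
  finally have "real (layer_count W * layer_cost (center_rounds n) D + m)
      \<le> 801793 * (L ^ 4 * (y * z))"
    using layers by simp
  then show ?thesis by (simp add: L_def y_def z_def mult.assoc)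
qed

lemma vdegree_le_max_degree: "simple_graph V E \<Longrightarrow> \<forall>v\<in>V. vdegree E v \<le> max_degree V E"
  by (auto simp: simple_graph_def max_degree_def)

lemma expected_queries_reconstruct_le:
  assumes graph: "simple_graph V E" and "E \<noteq> {}" "3 \<le> card V" "3 \<le> max_degree V E" "0 < \<alpha>"
    and weights: "\<forall>e\<in>E. w e \<in> {1..real (card E) powr (2 / \<alpha>)}"
  defines "n \<equiv> real (card V)" and "D \<equiv> real (max_degree V E)"
  shows "expected_queries (answer E w) (reconstruct V (max_weight E w)) \<le>
    ennreal (801793 * ln n ^ 4 * ((1 + 1 / \<alpha> * ln D) * D ^ 3 * n powr (3 / 2)))"
proof -
  have finite: "finite E" using graph by (rule simple_graph_finite_edges)
  have w_ge: "\<forall>e\<in>E. 1 \<le> w e" using weights by simp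
  have "max_weight E w \<le> real (card E) powr (2 / \<alpha>)"
    using weights finite assms(2) by (simp add: max_weight_def)
  moreover have "1 \<le> card E" using finite assms(2) by (simp add: Suc_le_eq card_gt_0_iff)
  ultimately have "real (layer_count (max_weight E w) *
        layer_cost (center_rounds (card V)) (max_degree V E) + card E)
      \<le> 801793 * ln n ^ 4 * ((1 + 1 / \<alpha> * ln D) * D ^ 3 * n powr (3 / 2))"
    unfolding n_def D_def
    using assms(3-5) max_weight_ge_one[OF graph assms(2) w_ge] card_edges_le_square[OF graph]
      card_edges_le_degree[OF graph vdegree_le_max_degree[OF graph]]
    by (intro reconstruct_cost_le)
  moreover have "expected_queries (answer E w) (reconstruct V (max_weight E w)) \<le>
      of_nat (layer_count (max_weight E w) *
        layer_cost (center_rounds (card V)) (max_degree V E) + card E)"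
    using computes_reconstruct[OF graph assms(2) w_ge vdegree_le_max_degree[OF graph]]
    by (simp add: computes_def)
  ultimately show ?thesis
    unfolding ennreal_of_nat_eq_real_of_nat by (meson ennreal_leI order_trans)
qed

lemma asymptotically_almost_surelyI:
  assumes prob: "\<And>i. prob_space (M i)" and lim: "\<epsilon> \<longlonglongrightarrow> 0"
    and eventually: "eventually (\<lambda>i. G i \<in> sets (M i) \<and> 1 - \<epsilon> i \<le> measure (M i) (G i) \<and>
      (\<forall>\<omega>\<in>G i. P i \<omega>)) sequentially"
  shows "asymptotically_almost_surely M P"
  unfolding asymptotically_almost_surely_def
proof (intro exI[of _ "\<lambda>i. if G i \<in> sets (M i) \<and> (\<forall>\<omega>\<in>G i. P i \<omega>) then G i else {}"] conjI)
  let ?A = "\<lambda>i. if G i \<in> sets (M i) \<and> (\<forall>\<omega>\<in>G i. P i \<omega>) then G i else {}"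
  show "\<forall>i. ?A i \<in> sets (M i) \<and> (\<forall>\<omega>\<in>?A i. P i \<omega>)" by simp
  have "(\<lambda>i. 1 - \<epsilon> i) \<longlonglongrightarrow> 1 - 0" using lim by (intro tendsto_diff tendsto_const)
  then have lower: "(\<lambda>i. 1 - \<epsilon> i) \<longlonglongrightarrow> 1" by simp
  show "(\<lambda>i. measure (M i) (?A i)) \<longlonglongrightarrow> 1"
  proof (rule tendsto_sandwich[OF _ _ lower tendsto_const])
    show "eventually (\<lambda>i. 1 - \<epsilon> i \<le> measure (M i) (?A i)) sequentially"
      using eventually by eventually_elim auto
    show "eventually (\<lambda>i. measure (M i) (?A i) \<le> 1) sequentially"
      using prob by (intro always_eventually allI prob_space.prob_le_1)
  qed
qed

lemma expected_queries_reconstruct_asymptotically_almost_surely: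
  fixes V :: "nat \<Rightarrow> 'v set" and E :: "nat \<Rightarrow> 'v set set" and M :: "nat \<Rightarrow> 'a measure"
    and X :: "nat \<Rightarrow> 'v set \<Rightarrow> 'a \<Rightarrow> real"
  defines "n \<equiv> \<lambda>i. real (card (V i))" and "D \<equiv> \<lambda>i. real (max_degree (V i) (E i))"
  assumes "0 < \<alpha>" and graph: "\<And>i. simple_graph (V i) (E i)"
    and iid: "\<And>i. iid_pareto_weights (M i) \<alpha> (E i) (X i)"
    and vertices: "filterlim (\<lambda>i. card (V i)) at_top sequentially"
    and degree: "filterlim (\<lambda>i. max_degree (V i) (E i)) at_top sequentially"
    and edges: "filterlim (\<lambda>i. real (card (E i)) / D i) at_top sequentially"
  shows "asymptotically_almost_surely M (\<lambda>i \<omega>.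
    expected_queries (answer (E i) (\<lambda>e. X i e \<omega>))
      (reconstruct (V i) (max_weight (E i) (\<lambda>e. X i e \<omega>)))
    \<le> ennreal (801793 * ln (n i) ^ 4 * ((1 + 1 / \<alpha> * ln (D i)) * D i ^ 3 * n i powr (3 / 2))))"
proof (rule asymptotically_almost_surelyI[where G = "\<lambda>i. moderate_weights (M i) \<alpha> (E i) (X i)"])
  show "prob_space (M i)" for i using iid by (simp add: iid_pareto_weights_def)
  have large: "eventually (\<lambda>i. 3 \<le> max_degree (V i) (E i)) sequentially"
    "eventually (\<lambda>i. 3 \<le> card (V i)) sequentially"
    "eventually (\<lambda>i. 1 \<le> real (card (E i)) / D i) sequentially"
    using vertices degree edges by (auto simp: filterlim_at_top)
  have "filterlim (\<lambda>i. real (card (E i))) at_top sequentially"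
    using edges
  proof (rule filterlim_at_top_mono)
    show "eventually (\<lambda>i. real (card (E i)) / D i \<le> real (card (E i))) sequentially"
      using large(1) by eventually_elim (simp add: D_def divide_le_eq mult_le_cancel_left1)
  qed
  then show "(\<lambda>i. 1 / real (card (E i))) \<longlonglongrightarrow> 0"
    by (intro tendsto_divide_0[OF tendsto_const] filterlim_at_top_imp_at_infinity)
  show "eventually (\<lambda>i. moderate_weights (M i) \<alpha> (E i) (X i) \<in> sets (M i) \<and>
      1 - 1 / real (card (E i)) \<le> measure (M i) (moderate_weights (M i) \<alpha> (E i) (X i)) \<and>
      (\<forall>\<omega>\<in>moderate_weights (M i) \<alpha> (E i) (X i). expected_queries (answer (E i) (\<lambda>e. X i e \<omega>))
          (reconstruct (V i) (max_weight (E i) (\<lambda>e. X i e \<omega>)))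
        \<le> ennreal (801793 * ln (n i) ^ 4 *
            ((1 + 1 / \<alpha> * ln (D i)) * D i ^ 3 * n i powr (3 / 2))))) sequentially"
    using large
  proof eventually_elim
    case (elim i)
    then have "E i \<noteq> {}" by auto
    then show ?case
      unfolding n_def D_def using elim \<open>0 < \<alpha>\<close>
        prob_moderate_weights[OF iid[of i] \<open>0 < \<alpha>\<close> simple_graph_finite_edges[OF graph]]
      by (intro conjI ballI expected_queries_reconstruct_le graph)
        (simp_all add: moderate_weights_def)
  qed
qed

theorem theorem2:
  "\<exists>(alg :: 'v set \<Rightarrow> real \<Rightarrow> ('v, 'v set set \<times> ('v set \<Rightarrow> real)) query_alg) (C :: real) (k :: nat).
     (\<forall>V W. finite V \<longrightarrow> legal_alg V (alg V W)) \<and>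
     (\<forall>V E w. simple_graph V E \<and> E \<noteq> {} \<and> (\<forall>e\<in>E. 1 \<le> w e) \<longrightarrow>
        (\<forall>((E', w'), c) \<in> set_pmf (run_alg (answer E w) (alg V (max_weight E w))).
           E' = E \<and> (\<forall>e\<in>E. w' e = w e))) \<and>
     (\<forall>(\<alpha> :: real) (V :: nat \<Rightarrow> 'v set) (E :: nat \<Rightarrow> 'v set set)
        (M :: nat \<Rightarrow> 'a measure) (X :: nat \<Rightarrow> 'v set \<Rightarrow> 'a \<Rightarrow> real).
        \<alpha> > 0 \<and>
        (\<forall>i. simple_graph (V i) (E i)) \<and>
        (\<forall>i. iid_pareto_weights (M i) \<alpha> (E i) (X i)) \<and>
        filterlim (\<lambda>i. card (V i)) at_top sequentially \<and>
        filterlim (\<lambda>i. max_degree (V i) (E i)) at_top sequentially \<and>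
        filterlim (\<lambda>i. real (card (E i)) / real (max_degree (V i) (E i))) at_top sequentially \<longrightarrow>
        asymptotically_almost_surely M (\<lambda>i \<omega>.
          let n = real (card (V i)); D = real (max_degree (V i) (E i)); w = (\<lambda>e. X i e \<omega>) in
          expected_queries (answer (E i) w) (alg (V i) (max_weight (E i) w))
            \<le> ennreal (C * ln n ^ k * ((1 + 1 / \<alpha> * ln D) * D ^ 3 * n powr (3 / 2)))))"
proof (intro exI[of _ reconstruct] exI[of _ "801793 :: real"] exI[of _ "4 :: nat"] conjI allI impI)
  show "finite V \<Longrightarrow> legal_alg V (reconstruct V W)" for V :: "'v set" and W
    by (rule legal_reconstruct)
next
  fix V :: "'v set" and E and w :: "'v set \<Rightarrow> real"
  assume "simple_graph V E \<and> E \<noteq> {} \<and> (\<forall>e\<in>E. 1 \<le> w e)"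
  then have "computes (answer E w) (reconstruct V (max_weight E w)) (E, restrict w E)
      (layer_count (max_weight E w) * layer_cost (center_rounds (card V)) (max_degree V E) +
        card E)"
    by (intro computes_reconstruct vdegree_le_max_degree) simp_all
  from computes_resultD[OF this]
  show "\<forall>((E', w'), c) \<in> set_pmf (run_alg (answer E w) (reconstruct V (max_weight E w))).
      E' = E \<and> (\<forall>e\<in>E. w' e = w e)"
    by fastforce
qed (unfold Let_def, elim conjE, rule expected_queries_reconstruct_asymptotically_almost_surely; blast)

end
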